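(* Let $\omega>-m^{2s}$ and $1<p<+\infty$. Assume that $u\in\mathcal{L}_s(\mathbb{R}^N)\cap C^{1,1}_{loc}(\mathbb{R}^N)$ is a nonnegative solution of $$(-\Delta+m^2)^s u(x)+\omega u(x)=u^p(x),\qquad x\in\mathbb{R}^N.$$ If $$\limsup_{|x|\to+\infty}u(x)=l<\left(\frac{\omega+m^{2s}}{p}\right)^{\frac1{p-1}},$$ then $u$ is radially symmetric and monotone decreasing about some point in $\mathbb{R}^N$.
   Context: Let $N\ge 1$ be an integer, $0<s<1$, $m>0$. $K_\nu$ is the modified Bessel function of the second kind of order $\nu$, $K_\nu(r)=\int_0^\infty e^{-r\cosh t}\cosh(\nu t)\,dt$ for $r>0$. The operator $(-\Delta+m^2)^s$ is defined by $$(-\Delta+m^2)^s u(x)=c_{N,s}m^{\frac N2+s}\,\mathrm{P.V.}\int_{\mathbb{R}^N}\frac{u(x)-u(y)}{|x-y|^{\frac N2+s}}K_{\frac N2+s}(m|x-y|)\,dy+m^{2s}u(x),\qquad c_{N,s}=2^{1-\frac N2+s}\pi^{-\frac N2}\frac{s(1-s)}{\Gamma(2-s)},$$ where P.V. denotes the Cauchy principal value. The function space is $\mathcal{L}_s(\mathbb{R}^N)=\{u:\mathbb{R}^N\to\mathbb{R}\,:\,\int_{\mathbb{R}^N}\frac{e^{-|x|}|u(x)|}{1+|x|^{\frac{N+1}2+s}}dx<\infty\}$. $C^{1,1}_{loc}$ denotes $C^1$ functions with locally Lipschitz gradient. *)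

theory Defs
  imports "HOL-Analysis.Analysis"
begin

definition bessel_K :: "real \<Rightarrow> real \<Rightarrow> real" where
  "bessel_K \<nu> r = (LINT t:{0..}|lborel. exp (- (r * cosh t)) * cosh (\<nu> * t))"

definition pv_exists :: "('a::euclidean_space \<Rightarrow> real) \<Rightarrow> 'a \<Rightarrow> bool" where
  "pv_exists f x \<longleftrightarrow>
     (\<forall>\<epsilon>>0. set_integrable lborel (- ball x \<epsilon>) f) \<and>
     (\<exists>I. ((\<lambda>\<epsilon>. LINT y:- ball x \<epsilon>|lborel. f y) \<longlongrightarrow> I) (at_right 0))"

text \<open>This is the intended value only if \<^term>\<open>pv_exists f x\<close>.\<close>

definition pv_integral :: "('a::euclidean_space \<Rightarrow> real) \<Rightarrow> 'a \<Rightarrow> real" where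
  "pv_integral f x = Lim (at_right 0) (\<lambda>\<epsilon>. LINT y:- ball x \<epsilon>|lborel. f y)"

definition c_const :: "nat \<Rightarrow> real \<Rightarrow> real" where
  "c_const N s = 2 powr (1 - real N / 2 + s) * pi powr (- (real N / 2)) *
     (s * (1 - s) / Gamma (2 - s))"

definition frac_integrand ::
    "real \<Rightarrow> real \<Rightarrow> ('a::euclidean_space \<Rightarrow> real) \<Rightarrow> 'a \<Rightarrow> 'a \<Rightarrow> real" where
  "frac_integrand m s u x y =
     (u x - u y) / norm (x - y) powr (real DIM('a) / 2 + s) *
     bessel_K (real DIM('a) / 2 + s) (m * norm (x - y))"

text \<open>The operator \<open>(-\<Delta> + m\<^sup>2)\<^sup>s\<close>.\<close>

definition frac_op ::
    "real \<Rightarrow> real \<Rightarrow> ('a::euclidean_space \<Rightarrow> real) \<Rightarrow> 'a \<Rightarrow> real" where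
  "frac_op m s u x =
     c_const DIM('a) s * m powr (real DIM('a) / 2 + s) *
       pv_integral (frac_integrand m s u x) x
     + m powr (2 * s) * u x"

definition L_space :: "real \<Rightarrow> ('a::euclidean_space \<Rightarrow> real) set" where
  "L_space s = {u. integrable lborel
     (\<lambda>x. exp (- norm x) * \<bar>u x\<bar> / (1 + norm x powr ((real DIM('a) + 1) / 2 + s)))}"

text \<open>Continuity of the gradient follows from its local Lipschitz continuity.\<close>

definition C11_loc :: "('a::euclidean_space \<Rightarrow> real) set" where
  "C11_loc = {u. \<exists>g. (\<forall>x. GDERIV u x :> g x) \<and>
     (\<forall>x. \<exists>\<epsilon>>0. \<exists>L. L-lipschitz_on (ball x \<epsilon>) g)}"

text \<open>Pointwise solutions of \<open>(-\<Delta> + m\<^sup>2)\<^sup>s u + \<omega> u = u\<^sup>p\<close>; that the principal value exists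
  is part of the equation being meaningful at \<open>x\<close>. The power is \<^const>\<open>powr\<close>, which is the
  right one (with \<open>0 powr p = 0\<close>) for nonnegative \<open>u\<close>.\<close>

definition is_solution ::
    "real \<Rightarrow> real \<Rightarrow> real \<Rightarrow> real \<Rightarrow> ('a::euclidean_space \<Rightarrow> real) \<Rightarrow> bool" where
  "is_solution m s \<omega> p u \<longleftrightarrow>
     (\<forall>x. pv_exists (frac_integrand m s u x) x \<and>
          frac_op m s u x + \<omega> * u x = u x powr p)"

text \<open>``Decreasing'' is meant in the weak sense: the zero function is a solution.\<close>

definition radial_decreasing_about ::
    "'a::euclidean_space \<Rightarrow> ('a \<Rightarrow> real) \<Rightarrow> bool" where
  "radial_decreasing_about x0 u \<longleftrightarrow>
     (\<exists>\<phi>. antimono_on {0..} \<phi> \<and> (\<forall>x. u x = \<phi> (norm (x - x0))))"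

end

theory Submission
  imports Defs
begin

text \<open>The proof is the method of moving planes. Dividing the equation by the positive constant in front of the integral
turns it into the statement that the principal value of \<open>\<integral> (u x - u y) k(|x - y|) dy\<close> is \<open>g (u x)\<close>, where \<open>g t\<close> is a
positive multiple of \<open>t\<^sup>p - (\<omega> + m\<^sup>2\<^sup>s) t\<close> and \<open>k r = K\<^sub>\<nu>(m r) / r\<^sup>\<nu>\<close> with \<open>\<nu> = N/2 + s\<close>.
What matters about \<open>k\<close> is that it is positive and strictly decreasing, that \<open>min(1,|h|\<^sup>2) k(|h|)\<close> is integrable, and that \<open>r\<^sup>N k(r)\<close> tends to infinity as \<open>r\<close> tends
to 0; what matters about \<open>g\<close> is that it is decreasing with a definite slope on \<open>[0,\<l>]\<close>, where
\<open>\<l>\<close> is a bound for \<open>u\<close> near infinity (this is the hypothesis on the limit superior, since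
\<open>p \<l>\<^sup>p\<^sup>-\<^sup>1 < \<omega> + m\<^sup>2\<^sup>s\<close>), and Lipschitz from above on the range of \<open>u\<close>. The locale
\<open>nonlocal_equation\<close> collects these properties, and the symmetry is proved there.

For a unit vector \<open>e\<close> and a plane \<open>x \<bullet> e = c\<close> with reflection \<open>R\<close>, put \<open>w = u \<circ> R - u\<close>. This function
is odd under \<open>R\<close>, so in the nonlocal operator the points \<open>y\<close> and \<open>R y\<close> can be paired; as \<open>k\<close> decreases, at a
negative minimum \<open>z\<close> of \<open>w\<close> over the half-space \<open>x \<bullet> e \<le> c\<close> every pair contributes with the same sign.
Hence \<open>g(u(R z)) - g(u z)\<close> is at most \<open>2 w z\<close> times the mass of the kernel centred at \<open>z\<close> on the opposite
half-space. This is impossible if \<open>u z \<le> \<l>\<close>, by the monotonicity of \<open>g\<close>, and impossible if \<open>z\<close> is close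
to the plane, because that mass is then larger than the Lipschitz constant of \<open>g\<close>. The infimum of
\<open>w\<close> need not be attained; subtracting a small multiple of a bump centred at an almost minimal point
produces a minimum and costs an error proportional to the size of the bump
(\<open>minimum_inequality\<close>, \<open>minimum_principle\<close>).

Far away planes therefore satisfy \<open>w \<ge> 0\<close>. If \<open>u \<le> \<l>\<close> everywhere then all planes do, in both
orientations, and \<open>u\<close> is constant. Otherwise the planes can be moved only up to a last position. There
\<open>w\<close> vanishes identically: if not, it would be positive inside (\<open>strong_minimum_principle\<close>), hence positive
on a compact set also for slightly larger \<open>c\<close>, and outside that compact set the minimum principle applies. So every
direction has a plane of symmetry (\<open>exists_symmetry_plane\<close>). All these planes pass through one point, since
otherwise \<open>u\<close> would have a nontrivial period while exceeding \<open>\<l>\<close> only on a bounded set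
(\<open>symmetric_about_common_point\<close>).\<close>

section \<open>Isometric involutions and radial integrals\<close>

text \<open>By Vitali's theorem an open set is, up to a null set, a disjoint union of balls, and an isometry maps
balls to balls of the same radius; the preimages of these balls fit disjointly into the preimage of the set.\<close>

lemma emeasure_involution_le:
  fixes f :: "'a::euclidean_space \<Rightarrow> 'a"
  assumes dist: "\<And>x y. dist (f x) (f y) = dist x y" and inv: "\<And>x. f (f x) = x"
    and U: "open U"
  shows "emeasure lborel U \<le> emeasure lborel (f -` U)"
proof -
  define K where "K = {(a, r::real). 0 < r \<and> ball a r \<subseteq> U}"
  have "\<exists>i. i \<in> K \<and> x \<in> ball (fst i) (snd i) \<and> snd i < d" if "x \<in> U" "0 < d" for x d
  proof -
    obtain e where e: "e > 0" "ball x e \<subseteq> U" using U \<open>x \<in> U\<close> openE by blast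
    have "ball x (min e (d/2)) \<subseteq> ball x e" by (auto simp: subset_iff)
    then have "(x, min e (d/2)) \<in> K" using e that unfolding K_def by auto
    then show ?thesis using e that by (intro exI[of _ "(x, min e (d/2))"]) auto
  qed
  then obtain C where C: "countable C" "C \<subseteq> K"
     "pairwise (\<lambda>i j. disjnt (ball (fst i) (snd i)) (ball (fst j) (snd j))) C"
     "negligible (U - (\<Union>i \<in> C. ball (fst i) (snd i)))"
    using Vitali_covering_theorem_balls[of U K fst snd] by blast
  have fball: "f -` ball a r = ball (f a) r" for a r
  proof -
    have "dist a (f x) = dist (f a) x" for x by (metis dist inv)
    then show ?thesis by auto
  qed
  have fm: "f -` A \<in> sets borel" if "A \<in> sets borel" for A
  proof -
    have "continuous_on UNIV f"
      unfolding continuous_on_iff using dist by auto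
    then have "f \<in> borel_measurable borel" by (rule borel_measurable_continuous_onI)
    from measurable_sets[OF this that] show ?thesis by simp
  qed
  have disj: "disjoint_family_on (\<lambda>i. ball (fst i) (snd i)) C"
    using C(3) unfolding disjoint_family_on_def pairwise_def disjnt_def by blast
  have disj': "disjoint_family_on (\<lambda>i. f -` ball (fst i) (snd i)) C"
    using disj unfolding disjoint_family_on_def by blast
  let ?V = "\<Union>i \<in> C. ball (fst i) (snd i)"
  have Vo: "open ?V" by auto
  have VU: "?V \<subseteq> U" using C(2) by (force simp: K_def)
  have null: "U - ?V \<in> null_sets lborel"
    using C(4) U Vo by (simp add: negligible_iff_null_sets null_sets_completion_iff)
  have "emeasure lborel U = emeasure lborel (?V \<union> (U - ?V))"
    using VU by (simp add: Un_absorb1)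
  also have "\<dots> = emeasure lborel ?V"
    using null Vo by (intro emeasure_Un_null_set) auto
  also have "\<dots> = (\<integral>\<^sup>+i. emeasure lborel (ball (fst i) (snd i)) \<partial>count_space C)"
    using C(1) disj by (intro emeasure_UN_countable) auto
  also have "\<dots> = (\<integral>\<^sup>+i. emeasure lborel (f -` ball (fst i) (snd i)) \<partial>count_space C)"
    using C(2) by (intro nn_integral_cong) (auto simp: fball emeasure_ball K_def)
  also have "\<dots> = emeasure lborel (\<Union>i\<in>C. f -` ball (fst i) (snd i))"
    using C(1) disj' by (intro emeasure_UN_countable[symmetric]) (auto simp: fm)
  also have "\<dots> \<le> emeasure lborel (f -` U)"
    using VU U by (intro emeasure_mono) (auto simp: fm)
  finally show ?thesis .
qed

lemma lborel_distr_involution: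
  fixes f :: "'a::euclidean_space \<Rightarrow> 'a"
  assumes dist: "\<And>x y. dist (f x) (f y) = dist x y" and inv: "\<And>x. f (f x) = x"
  shows "distr lborel borel f = lborel"
proof (rule lborel_eqI[symmetric])
  have cf: "continuous_on UNIV f"
    unfolding continuous_on_iff using dist by auto
  have fm: "f \<in> borel_measurable borel"
    using cf by (rule borel_measurable_continuous_onI)
  fix l u :: 'a assume le: "\<And>b. b \<in> Basis \<Longrightarrow> l \<bullet> b \<le> u \<bullet> b"
  have o: "open (f -` box l u)"
    using cf open_box by (auto intro: open_vimage)
  have "f -` (f -` box l u) = box l u" by (auto simp: inv)
  then have "emeasure lborel (f -` box l u) = emeasure lborel (box l u)"
    using emeasure_involution_le[OF dist inv open_box, of l u]
      emeasure_involution_le[OF dist inv o] by (metis antisym)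
  then show "emeasure (distr lborel borel f) (box l u) = (\<Prod>b\<in>Basis. (u - l) \<bullet> b)"
    using fm le by (simp add: emeasure_distr emeasure_lborel_box_eq)
qed simp

lemma
  fixes f :: "'a::euclidean_space \<Rightarrow> 'a" and F :: "'a \<Rightarrow> real"
  assumes dist: "\<And>x y. dist (f x) (f y) = dist x y" and inv: "\<And>x. f (f x) = x"
  shows integral_involution: "(LINT y|lborel. F (f y)) = (LINT y|lborel. F y)"
    and integrable_involution: "integrable lborel F \<Longrightarrow> integrable lborel (\<lambda>y. F (f y))"
proof -
  have cf: "continuous_on UNIV f"
    unfolding continuous_on_iff using dist by auto
  have fm[measurable]: "f \<in> borel_measurable borel"
    using cf by (rule borel_measurable_continuous_onI)
  note D = lborel_distr_involution[OF dist inv]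
  show *: "integrable lborel (\<lambda>y. F (f y))" if "integrable lborel F" for F :: "'a \<Rightarrow> real"
  proof -
    have "F \<in> borel_measurable borel" using that borel_measurable_integrable by auto
    then show ?thesis using that integrable_distr_eq[of f lborel borel F] D by simp
  qed
  show "(LINT y|lborel. F (f y)) = (LINT y|lborel. F y)"
  proof (cases "integrable lborel F")
    case True
    then have "F \<in> borel_measurable borel" using borel_measurable_integrable by auto
    then show ?thesis using integral_distr[of f lborel borel F] D by simp
  next
    case False
    then have "\<not> integrable lborel (\<lambda>y. F (f y))"
      using *[of "\<lambda>y. F (f y)"] by (auto simp: inv)
    then show ?thesis using False by (simp add: not_integrable_integral_eq)
  qed
qed

text \<open>Dyadic decomposition in a form that avoids polar coordinates: each value of the function is charged to one
of countably many balls, whose volumes are known.\<close>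

lemma integrable_radial_if_dominated_by_balls:
  fixes f :: "'a::euclidean_space \<Rightarrow> real"
  assumes meas: "f \<in> borel_measurable borel" and nn: "\<And>x. 0 \<le> f x"
    and c: "\<And>k. 0 \<le> c k" and R: "\<And>k. 0 \<le> R k"
    and dom: "\<And>x. f x \<noteq> 0 \<Longrightarrow> \<exists>k. x \<in> ball 0 (R k) \<and> f x \<le> c k"
    and summ: "summable (\<lambda>k::nat. c k * R k ^ DIM('a))"
  shows "integrable lborel f"
proof (rule integrableI_nonneg)
  have "(\<integral>\<^sup>+x. ennreal (f x) \<partial>lborel) \<le> (\<integral>\<^sup>+x. (\<Sum>k. ennreal (c k) * indicator (ball (0::'a) (R k)) x) \<partial>lborel)"
  proof (rule nn_integral_mono)
    fix x :: 'a
    show "ennreal (f x) \<le> (\<Sum>k. ennreal (c k) * indicator (ball 0 (R k)) x)"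
    proof (cases "f x = 0")
      case False
      from dom[OF this] obtain k where k: "x \<in> ball 0 (R k)" "f x \<le> c k" by blast
      have "ennreal (f x) \<le> ennreal (c k) * indicator (ball 0 (R k)) x"
        using k by (simp add: ennreal_leI)
      also have "\<dots> \<le> (\<Sum>k. ennreal (c k) * indicator (ball 0 (R k)) x)"
        using sum_le_suminf[OF summableI, of "{k}" "\<lambda>k. ennreal (c k) * indicator (ball 0 (R k)) x"]
        by (simp del: sum_mult_indicator)
      finally show ?thesis .
    qed simp
  qed
  also have "\<dots> = (\<Sum>k. \<integral>\<^sup>+x. ennreal (c k) * indicator (ball (0::'a) (R k)) x \<partial>lborel)"
    by (intro nn_integral_suminf borel_measurable_times_ennreal borel_measurable_const
        borel_measurable_indicator) simp
  also have "\<dots> = (\<Sum>k. ennreal (unit_ball_vol DIM('a) * (c k * R k ^ DIM('a))))"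
    by (intro suminf_cong)
       (simp add: nn_integral_cmult_indicator emeasure_ball R c ennreal_mult'[symmetric] mult_ac)
  also have "\<dots> = ennreal (\<Sum>k. unit_ball_vol DIM('a) * (c k * R k ^ DIM('a)))"
    using summ c R by (intro suminf_ennreal2 summable_mult) auto
  also have "\<dots> < \<infinity>" by simp
  finally show "(\<integral>\<^sup>+x. ennreal (f x) \<partial>lborel) < \<infinity>" .
qed (use meas nn in auto)

section \<open>Reflections and semiconvex bumps\<close>

definition mirror :: "'a::real_inner \<Rightarrow> real \<Rightarrow> 'a \<Rightarrow> 'a" where
  "mirror e c x = x - (2 * (x \<bullet> e - c)) *\<^sub>R e"

text \<open>All comparisons of distances to a point and to its mirror image come from this identity.\<close>

lemma norm_mirror_diff_sq:
  assumes "norm e = 1"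
  shows "(norm (mirror e c z - y))\<^sup>2 = (norm (z - y))\<^sup>2 + 4 * (z \<bullet> e - c) * (y \<bullet> e - c)"
proof -
  have ee: "e \<bullet> e = 1" using assms by (simp add: norm_eq_1)
  show ?thesis
    unfolding mirror_def power2_norm_eq_inner
    by (simp add: inner_diff_left inner_diff_right ee inner_commute algebra_simps power2_eq_square)
qed

lemma inner_mirror: "norm e = 1 \<Longrightarrow> mirror e c x \<bullet> e = 2 * c - x \<bullet> e"
  by (simp add: mirror_def inner_diff_left norm_eq_1)

lemma mirror_mirror: "norm e = 1 \<Longrightarrow> mirror e c (mirror e c x) = x"
  unfolding mirror_def[of e c "mirror e c x"] inner_mirror
  by (simp add: mirror_def algebra_simps)

lemma mirror_fixed: "x \<bullet> e = c \<Longrightarrow> mirror e c x = x"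
  by (simp add: mirror_def)

lemma dist_mirror:
  assumes "norm e = 1"
  shows "dist (mirror e c x) (mirror e c y) = dist x y"
proof -
  have "(norm (mirror e c x - mirror e c y))\<^sup>2 = (norm (x - y))\<^sup>2"
    using norm_mirror_diff_sq[OF assms, of c x "mirror e c y"]
      norm_mirror_diff_sq[OF assms, of c y x]
    by (simp add: norm_minus_commute inner_mirror[OF assms] algebra_simps)
  then show ?thesis by (simp add: dist_norm)
qed

lemma norm_diff_mirror:
  assumes "norm e = 1"
  shows "norm (z - mirror e c y) = norm (mirror e c z - y)"
  using dist_mirror[OF assms, of c "mirror e c z" y] by (simp add: mirror_mirror assms dist_norm)

lemma norm_diff_le_mirror:
  assumes "norm e = 1" "z \<bullet> e \<le> c" "y \<bullet> e \<le> c"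
  shows "norm (z - y) \<le> norm (mirror e c z - y)"
proof (rule power2_le_imp_le)
  have "0 \<le> (z \<bullet> e - c) * (y \<bullet> e - c)" using assms by (intro mult_nonpos_nonpos) auto
  then show "(norm (z - y))\<^sup>2 \<le> (norm (mirror e c z - y))\<^sup>2"
    by (simp only: norm_mirror_diff_sq[OF assms(1)] mult.assoc)
qed simp

lemma norm_diff_less_mirror:
  assumes "norm e = 1" "z \<bullet> e < c" "y \<bullet> e < c"
  shows "norm (z - y) < norm (mirror e c z - y)"
proof (rule power2_less_imp_less)
  have "0 < (z \<bullet> e - c) * (y \<bullet> e - c)" using assms by (intro mult_neg_neg) auto
  then show "(norm (z - y))\<^sup>2 < (norm (mirror e c z - y))\<^sup>2"
    by (simp only: norm_mirror_diff_sq[OF assms(1)] mult.assoc)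
qed simp

lemma norm_mirror_diff_ge:
  assumes "norm e = 1" "y \<bullet> e \<le> c"
  shows "c - z \<bullet> e \<le> norm (mirror e c z - y)"
proof -
  have "c - z \<bullet> e \<le> (mirror e c z - y) \<bullet> e"
    using assms by (simp add: inner_diff_left inner_mirror)
  also have "\<dots> \<le> norm (mirror e c z - y)"
    using norm_cauchy_schwarz[of "mirror e c z - y" e] assms by simp
  finally show ?thesis .
qed

lemma continuous_on_mirror: "continuous_on A (mirror e c)"
  unfolding mirror_def by (intro continuous_intros)

lemma mirror_measurable [measurable]: "mirror e c \<in> borel_measurable (borel :: 'a::euclidean_space measure)"
  using continuous_on_mirror by (rule borel_measurable_continuous_onI)

text \<open>A truncated paraboloid. It has a convex kink on the unit sphere, which is harmless: the minimum argument
uses only an upper bound on \<open>2 f(z) - f(z + h) - f(z - h)\<close>, and a maximum of two functions inherits such a bound.\<close>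

definition bump :: "'a::real_inner \<Rightarrow> 'a \<Rightarrow> real" where
  "bump x0 x = max 0 (1 - (norm (x - x0))\<^sup>2)"

lemma bump_nonneg: "0 \<le> bump x0 x" and bump_le_1: "bump x0 x \<le> 1" and bump_center: "bump x0 x0 = 1"
  by (auto simp: bump_def)

lemma bump_outside: "x \<notin> cball x0 1 \<Longrightarrow> bump x0 x = 0"
  by (auto simp: bump_def max_def dist_norm norm_minus_commute)
     (smt (verit) one_le_power)

lemma bump_measurable [measurable]: "bump (x0::'a::euclidean_space) \<in> borel_measurable borel"
  unfolding bump_def by measurable

lemma continuous_on_bump: "continuous_on A (bump x0)"
  unfolding bump_def by (intro continuous_intros)

lemma bump_second_difference:
  "2 * bump x0 z - bump x0 (z + h) - bump x0 (z - h) \<le> 2 * min 1 ((norm h)\<^sup>2)"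
proof -
  have "(norm (z + h - x0))\<^sup>2 + (norm (z - h - x0))\<^sup>2 = 2 * (norm (z - x0))\<^sup>2 + 2 * (norm h)\<^sup>2"
    unfolding power2_norm_eq_inner
    by (simp add: inner_diff_left inner_diff_right inner_add_left inner_add_right inner_commute algebra_simps)
  moreover have "2 * max 0 (1 - a) - max 0 (1 - b) - max 0 (1 - c) \<le> 2 * min 1 d"
    if "b + c = 2 * a + 2 * d" "0 \<le> a" "0 \<le> b" "0 \<le> c" "0 \<le> d" for a b c d :: real
    using that by (auto simp: max_def min_def)
  ultimately show ?thesis unfolding bump_def by simp
qed

section \<open>Nonlocal equations with a decreasing kernel\<close>

text \<open>The kernel enters through its radial profile \<open>k\<close>, the zero order term and the nonlinearity through \<open>g\<close>.
Assumption \<open>k_sing\<close> says that the kernel has infinite mass near 0 in every cone; it is what makes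
narrow strips along the plane favourable. The constant \<open>\<l>\<close> is a bound for \<open>u\<close> near infinity below which \<open>g\<close> is decreasing.\<close>

locale nonlocal_equation =
  fixes k :: "real \<Rightarrow> real" and u :: "'a::euclidean_space \<Rightarrow> real" and g :: "real \<Rightarrow> real"
    and M \<l> \<gamma> \<Lambda> :: real
  assumes k_pos: "0 < r \<Longrightarrow> 0 < k r"
    and k_strict: "0 < r \<Longrightarrow> r < r' \<Longrightarrow> k r' < k r"
    and k_meas [measurable]: "k \<in> borel_measurable borel"
    and k_int: "integrable lborel (\<lambda>h::'a. min 1 ((norm h)\<^sup>2) * k (norm h))"
    and k_sing: "filterlim (\<lambda>r. r ^ DIM('a) * k r) at_top (at_right 0)"
    and u_cont: "continuous_on UNIV u"
    and u_nonneg: "0 \<le> u x" and u_le: "u x \<le> M"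
    and u_eq: "((\<lambda>\<epsilon>. LINT y:- ball x \<epsilon>|lborel. (u x - u y) * k (norm (x - y))) \<longlongrightarrow> g (u x))
          (at_right 0)"
    and u_far: "eventually (\<lambda>x. u x \<le> \<l>) at_infinity"
    and g_decr: "0 \<le> a \<Longrightarrow> a \<le> b \<Longrightarrow> b \<le> \<l> \<Longrightarrow> g b - g a \<le> - \<gamma> * (b - a)"
    and \<gamma>_pos: "0 < \<gamma>"
    and g_lip: "0 \<le> a \<Longrightarrow> a \<le> b \<Longrightarrow> b \<le> M \<Longrightarrow> g b - g a \<le> \<Lambda> * (b - a)"
begin

lemma u_measurable [measurable]: "u \<in> borel_measurable borel"
  using u_cont by (rule borel_measurable_continuous_onI)

lemma k_mono: "0 < r \<Longrightarrow> r \<le> r' \<Longrightarrow> k r' \<le> k r"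
  using k_strict[of r r'] by (cases "r = r'") auto

lemma integrable_kernel_off_ball:
  assumes "0 < \<epsilon>" and [measurable]: "\<phi> \<in> borel_measurable borel" and B: "\<And>y. \<bar>\<phi> y\<bar> \<le> B"
  shows "integrable lborel (\<lambda>y::'a. indicat_real (- ball z \<epsilon>) y * (\<phi> y * k (norm (z - y))))"
proof -
  define c where "c = min 1 (\<epsilon>\<^sup>2)"
  have c: "c > 0" using assms by (simp add: c_def)
  have B0: "0 \<le> B" using B[of 0] by linarith
  have "integrable lborel (\<lambda>y. min 1 ((norm (z - y))\<^sup>2) * k (norm (z - y)))"
    by (rule integrable_involution[OF _ _ k_int, of "\<lambda>y. z - y"]) (auto simp: dist_norm norm_minus_commute)
  then have "integrable lborel (\<lambda>y. (B / c) * (min 1 ((norm (z - y))\<^sup>2) * k (norm (z - y))))"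
    by simp
  then show ?thesis
  proof (rule Bochner_Integration.integrable_bound)
    show "AE y in lborel. norm (indicat_real (- ball z \<epsilon>) y * (\<phi> y * k (norm (z - y))))
        \<le> norm (B / c * (min 1 ((norm (z - y))\<^sup>2) * k (norm (z - y))))"
    proof (rule AE_I2)
      fix y :: 'a
      show "norm (indicat_real (- ball z \<epsilon>) y * (\<phi> y * k (norm (z - y))))
        \<le> norm (B / c * (min 1 ((norm (z - y))\<^sup>2) * k (norm (z - y))))"
      proof (cases "y \<in> ball z \<epsilon>")
        case False
        then have n: "\<epsilon> \<le> norm (z - y)" by (simp add: dist_norm)
        then have kp: "0 < k (norm (z - y))" using assms(1) by (intro k_pos) linarith
        have "c \<le> min 1 ((norm (z - y))\<^sup>2)"
          using power_mono[OF n, of 2] assms(1) by (auto simp: c_def intro: min.coboundedI2)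
        then have "1 \<le> min 1 ((norm (z - y))\<^sup>2) / c" using c by simp
        then have "\<bar>\<phi> y\<bar> * k (norm (z - y)) \<le> (B * (min 1 ((norm (z - y))\<^sup>2) / c)) * k (norm (z - y))"
          using B[of y] mult_left_mono[OF _ B0, of 1 "min 1 ((norm (z - y))\<^sup>2) / c"] kp
          by (intro mult_right_mono) linarith+
        then show ?thesis using False kp B0 c by (simp add: abs_mult)
      qed simp
    qed
  qed measurable
qed

definition kernel_weight :: real where
  "kernel_weight = (LINT h|lborel. min 1 ((norm (h::'a))\<^sup>2) * k (norm h))"

lemma k_weight_nonneg: "0 \<le> min 1 ((norm (h::'a))\<^sup>2) * k (norm h)"
  using k_pos[of "norm h"] by (cases "h = 0") auto

lemma kernel_weight_nonneg: "0 \<le> kernel_weight"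
  unfolding kernel_weight_def using k_weight_nonneg by (intro integral_nonneg_AE) auto

text \<open>The bound is uniform in the truncation radius, the point and the centre: averaging over \<open>h\<close> and \<open>- h\<close> replaces the first difference by a second difference, which the weight
\<open>min 1 |h|\<^sup>2\<close> controls.\<close>

lemma integral_bump_le:
  fixes z x0 :: 'a
  assumes "0 < \<epsilon>"
  shows "(LINT y|lborel. indicat_real (- ball z \<epsilon>) y * ((bump x0 z - bump x0 y) * k (norm (z - y)))) \<le> kernel_weight"
proof -
  define T where "T y = indicat_real (- ball z \<epsilon>) y * ((bump x0 z - bump x0 y) * k (norm (z - y)))" for y
  have iT: "integrable lborel T"
    unfolding T_def using assms
    by (intro integrable_kernel_off_ball[where B=1])
       (auto simp: abs_le_iff intro: bump_le_1 bump_nonneg order_trans diff_mono[OF bump_le_1 bump_nonneg])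
  have d1: "dist (z - x) (z - y) = dist x y" for x y by (simp add: dist_norm norm_minus_commute)
  have d2: "dist (2 *\<^sub>R z - x) (2 *\<^sub>R z - y) = dist x y" for x y by (simp add: dist_norm norm_minus_commute)
  have i1: "integrable lborel (\<lambda>h. T (z - h))"
    by (rule integrable_involution[OF d1 _ iT]) simp
  have e1: "(LINT h|lborel. T (z - h)) = (LINT y|lborel. T y)"
    by (rule integral_involution[OF d1]) simp
  have d3: "dist (- x) (- y) = dist x y" for x y :: 'a by (simp add: dist_norm norm_minus_commute)
  have i2: "integrable lborel (\<lambda>h. T (z + h))"
    using integrable_involution[OF d3 _ i1] by simp
  have e2: "(LINT h|lborel. T (z + h)) = (LINT y|lborel. T y)"
    using integral_involution[OF d3, of "\<lambda>h. T (z - h)"] e1 by simp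
  have "2 * (LINT y|lborel. T y) = (LINT h|lborel. T (z - h) + T (z + h))"
    using i1 i2 e1 e2 by simp
  also have "\<dots> \<le> (LINT h|lborel. 2 * (min 1 ((norm (h::'a))\<^sup>2) * k (norm h)))"
  proof (rule integral_mono)
    fix h :: 'a
    show "T (z - h) + T (z + h) \<le> 2 * (min 1 ((norm h)\<^sup>2) * k (norm h))"
    proof (cases "norm h < \<epsilon>")
      case True
      then show ?thesis using k_weight_nonneg[of h] by (simp add: T_def dist_norm)
    next
      case False
      then have kp: "0 < k (norm h)" using assms by (intro k_pos) linarith
      have "T (z - h) + T (z + h) = (2 * bump x0 z - bump x0 (z + h) - bump x0 (z - h)) * k (norm h)"
        using False by (simp add: T_def dist_norm algebra_simps)
      also have "\<dots> \<le> (2 * min 1 ((norm h)\<^sup>2)) * k (norm h)"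
        using kp bump_second_difference by (intro mult_right_mono) auto
      finally show ?thesis by simp
    qed
  qed (use i1 i2 k_int in auto)
  also have "\<dots> = 2 * kernel_weight" by (simp add: kernel_weight_def)
  finally show ?thesis unfolding T_def by simp
qed

definition refl_diff :: "'a \<Rightarrow> real \<Rightarrow> 'a \<Rightarrow> real" where
  "refl_diff e c x = u (mirror e c x) - u x"

lemma refl_diff_measurable [measurable]: "refl_diff e c \<in> borel_measurable borel"
  unfolding refl_diff_def by measurable

lemma continuous_on_refl_diff: "continuous_on A (refl_diff e c)"
  unfolding refl_diff_def
  by (intro continuous_intros continuous_on_compose2[OF u_cont] continuous_on_mirror) auto

lemma abs_refl_diff_le: "\<bar>refl_diff e c x\<bar> \<le> M"
  unfolding refl_diff_def using u_nonneg u_le by (smt (verit))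

lemma refl_diff_mirror: "norm e = 1 \<Longrightarrow> refl_diff e c (mirror e c x) = - refl_diff e c x"
  by (simp add: refl_diff_def mirror_mirror)

lemma refl_diff_plane: "x \<bullet> e = c \<Longrightarrow> refl_diff e c x = 0"
  by (simp add: refl_diff_def mirror_fixed)

lemma integrable_truncated_difference:
  fixes z :: 'a
  assumes "0 < \<epsilon>" and [measurable]: "\<phi> \<in> borel_measurable borel" and B: "\<And>y. \<bar>\<phi> y\<bar> \<le> B"
  shows "integrable lborel (\<lambda>y. indicat_real (- ball z \<epsilon>) y * ((\<phi> z - \<phi> y) * k (norm (z - y))))"
proof (rule integrable_kernel_off_ball[where B = "2 * B"])
  show "\<bar>\<phi> z - \<phi> y\<bar> \<le> 2 * B" for y using B[of y] B[of z] by linarith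
qed (use assms in auto)

text \<open>The reflected function solves the same equation because the reflection preserves the measure and the distances,
so the difference of the two equations is an equation for the reflected difference.\<close>

lemma tendsto_truncated_refl_diff:
  assumes e: "norm e = 1"
  shows "((\<lambda>\<epsilon>. LINT y|lborel. indicat_real (- ball z \<epsilon>) y *
            ((refl_diff e c z - refl_diff e c y) * k (norm (z - y))))
          \<longlongrightarrow> g (u (mirror e c z)) - g (u z)) (at_right 0)"
proof -
  let ?R = "mirror e c"
  let ?I = "\<lambda>x \<epsilon>. LINT y:- ball x \<epsilon>|lborel. (u x - u y) * k (norm (x - y))"
  have "((\<lambda>\<epsilon>. ?I (?R z) \<epsilon> - ?I z \<epsilon>) \<longlongrightarrow> g (u (?R z)) - g (u z)) (at_right 0)"
    by (intro tendsto_diff u_eq)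
  moreover have "eventually (\<lambda>\<epsilon>. ?I (?R z) \<epsilon> - ?I z \<epsilon> = (LINT y|lborel. indicat_real (- ball z \<epsilon>) y *
            ((refl_diff e c z - refl_diff e c y) * k (norm (z - y))))) (at_right (0::real))"
    using eventually_at_right_less
  proof (rule eventually_mono)
    fix \<epsilon> :: real assume "0 < \<epsilon>"
    define F where "F x y = indicat_real (- ball x \<epsilon>) y * ((u x - u y) * k (norm (x - y)))" for x y
    have iF: "integrable lborel (F x)" for x
      unfolding F_def using \<open>0 < \<epsilon>\<close>
      by (rule integrable_truncated_difference[where B = M]) (auto simp: u_nonneg u_le)
    have iR: "integrable lborel (\<lambda>y. F (?R z) (?R y))"
      using dist_mirror[OF e] mirror_mirror[OF e] iF by (rule integrable_involution)
    have "?I (?R z) \<epsilon> = (LINT y|lborel. F (?R z) y)"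
      by (simp add: F_def set_lebesgue_integral_def)
    also have "\<dots> = (LINT y|lborel. F (?R z) (?R y))"
      using integral_involution[OF dist_mirror[OF e] mirror_mirror[OF e]] by metis
    finally have "?I (?R z) \<epsilon> - ?I z \<epsilon> = (LINT y|lborel. F (?R z) (?R y)) - (LINT y|lborel. F z y)"
      by (simp add: F_def set_lebesgue_integral_def)
    also have "\<dots> = (LINT y|lborel. F (?R z) (?R y) - F z y)"
      using iF iR by simp
    also have "\<dots> = (LINT y|lborel. indicat_real (- ball z \<epsilon>) y *
            ((refl_diff e c z - refl_diff e c y) * k (norm (z - y))))"
    proof (rule Bochner_Integration.integral_cong)
      fix y
      have "norm (?R z - ?R y) = norm (z - y)" using dist_mirror[OF e, of c z y] by (simp add: dist_norm)
      moreover from this have "indicat_real (- ball (?R z) \<epsilon>) (?R y) = indicat_real (- ball z \<epsilon>) y"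
        by (simp add: indicator_def dist_norm)
      ultimately show "F (?R z) (?R y) - F z y = indicat_real (- ball z \<epsilon>) y *
            ((refl_diff e c z - refl_diff e c y) * k (norm (z - y)))"
        unfolding F_def refl_diff_def by (simp add: algebra_simps)
    qed simp
    finally show "?I (?R z) \<epsilon> - ?I z \<epsilon> = \<dots>" .
  qed
  ultimately show ?thesis by (rule Lim_transform_eventually)
qed

text \<open>Integrals can be compared by comparing the sums over pairs of mirror points. Since these sums are invariant under
the reflection, it suffices to look at one closed half-space.\<close>

lemma integral_symmetrised_le:
  fixes F P :: "'a \<Rightarrow> real"
  assumes e: "norm e = 1" and F: "integrable lborel F" and P: "integrable lborel P"
    and le: "\<And>y. y \<bullet> e \<le> c \<Longrightarrow> F y + F (mirror e c y) \<le> P y + P (mirror e c y)"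
  shows "(LINT y|lborel. F y) \<le> (LINT y|lborel. P y)"
proof -
  let ?R = "mirror e c"
  note inv = dist_mirror[OF e, of c] mirror_mirror[OF e, of c]
  have le': "F y + F (?R y) \<le> P y + P (?R y)" for y
  proof (cases "y \<bullet> e \<le> c")
    case False
    then have "?R y \<bullet> e \<le> c" by (simp add: inner_mirror e)
    from le[OF this] show ?thesis by (simp add: mirror_mirror e)
  qed (rule le)
  have "2 * (LINT y|lborel. F y) = (LINT y|lborel. F y + F (?R y))"
    using F integrable_involution[OF inv F] integral_involution[OF inv, of F] by simp
  also have "\<dots> \<le> (LINT y|lborel. P y + P (?R y))"
    using F P integrable_involution[OF inv F] integrable_involution[OF inv P] le'
    by (intro integral_mono) auto
  also have "\<dots> = 2 * (LINT y|lborel. P y)"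
    using P integrable_involution[OF inv P] integral_involution[OF inv, of P] by simp
  finally show ?thesis by simp
qed

text \<open>For \<open>y\<close> on the side of \<open>z\<close> this is the kernel between \<open>z\<close> and the mirror image of \<open>y\<close>; the maximum makes
the expression invariant under the reflection of \<open>y\<close>. Its integral is twice the mass that the kernel centred
at \<open>z\<close> has in the opposite half-space.\<close>

definition cross_kernel :: "'a \<Rightarrow> real \<Rightarrow> 'a \<Rightarrow> 'a \<Rightarrow> real" where
  "cross_kernel e c z y = k (max (norm (z - y)) (norm (mirror e c z - y)))"

lemma
  assumes e: "norm e = 1" and z: "z \<bullet> e < c"
  shows cross_kernel_pos: "0 < cross_kernel e c z y"
    and integrable_cross_kernel: "integrable lborel (cross_kernel e c z)"
proof -
  define d where "d = c - z \<bullet> e"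
  have d: "0 < d" using z by (simp add: d_def)
  let ?R = "mirror e c"
  have far: "d \<le> max (norm (z - y)) (norm (?R z - y))" for y
  proof (cases "y \<bullet> e \<le> c")
    case True
    then show ?thesis using norm_mirror_diff_ge[OF e True, of z] by (simp add: d_def max.coboundedI2)
  next
    case False
    then have "?R y \<bullet> e \<le> c" by (simp add: inner_mirror e)
    from norm_mirror_diff_ge[OF e this, of z] norm_diff_mirror[OF e, of "?R z" c y]
    show ?thesis by (simp add: d_def mirror_mirror e max.coboundedI1 dist_norm[symmetric] dist_mirror)
  qed
  show pos: "0 < cross_kernel e c z y" for y
    unfolding cross_kernel_def using far[of y] d by (intro k_pos) linarith
  have i: "integrable lborel (\<lambda>y. indicat_real (- ball x d) y * (1 * k (norm (x - y))))" for x :: 'a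
    by (rule integrable_kernel_off_ball[where B = 1, OF d]) auto
  have "integrable lborel (\<lambda>y. indicat_real (- ball z d) y * (1 * k (norm (z - y))) +
      indicat_real (- ball (?R z) d) y * (1 * k (norm (?R z - y))))"
    using i by simp
  then show "integrable lborel (cross_kernel e c z)"
  proof (rule Bochner_Integration.integrable_bound)
    show "AE y in lborel. norm (cross_kernel e c z y) \<le> norm (indicat_real (- ball z d) y * (1 * k (norm (z - y))) +
      indicat_real (- ball (?R z) d) y * (1 * k (norm (?R z - y))))"
    proof (rule AE_I2)
      fix y :: 'a
      have nn: "0 \<le> indicat_real (- ball x d) y * (1 * k (norm (x - y)))" for x :: 'a
      proof (cases "y \<in> ball x d")
        case False
        then have "0 < norm (x - y)" using d by (auto simp: dist_norm)
        from k_pos[OF this] show ?thesis by simp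
      qed simp
      have "cross_kernel e c z y \<le> indicat_real (- ball z d) y * (1 * k (norm (z - y))) +
          indicat_real (- ball (?R z) d) y * (1 * k (norm (?R z - y)))"
        using far[of y] nn[of z] nn[of "?R z"]
        by (auto simp: cross_kernel_def max_def dist_norm split: if_splits)
      then show "norm (cross_kernel e c z y) \<le> norm (indicat_real (- ball z d) y * (1 * k (norm (z - y))) +
          indicat_real (- ball (?R z) d) y * (1 * k (norm (?R z - y))))"
        using pos[of y] by simp
    qed
  qed (simp add: cross_kernel_def[abs_def])
qed

text \<open>At distance \<open>d\<close> from the plane, the points of the ball of radius \<open>d / 2\<close> around \<open>z\<close> are at distance at
most \<open>5 / 2 * d\<close> from the mirror image of \<open>z\<close>. With the singularity of the kernel this
forces the integral to blow up as \<open>d\<close> tends to 0.\<close>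

lemma cross_kernel_integral_ge:
  assumes e: "norm e = 1" and z: "z \<bullet> e < c"
  defines "d \<equiv> c - z \<bullet> e"
  shows "unit_ball_vol DIM('a) * (d / 2) ^ DIM('a) * k (5 / 2 * d) \<le> (LINT y|lborel. cross_kernel e c z y)"
proof -
  have d: "0 < d" using z by (simp add: d_def)
  have ee: "e \<bullet> e = 1" using e by (simp add: norm_eq_1)
  let ?B = "ball z (d / 2)"
  have "unit_ball_vol DIM('a) * (d / 2) ^ DIM('a) * k (5 / 2 * d) =
      (LINT y|lborel. indicat_real ?B y * k (5 / 2 * d))"
    using d by (simp add: content_ball)
  also have "\<dots> \<le> (LINT y|lborel. cross_kernel e c z y)"
  proof (rule integral_mono)
    have "integrable lborel (indicat_real ?B)"
      by (rule integrable_real_indicator) (use d in \<open>auto simp: emeasure_ball\<close>)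
    then show "integrable lborel (\<lambda>y. indicat_real ?B y * k (5 / 2 * d))" by simp
    fix y
    show "indicat_real ?B y * k (5 / 2 * d) \<le> cross_kernel e c z y"
    proof (cases "y \<in> ?B")
      case True
      then have n: "norm (z - y) < d / 2" by (simp add: dist_norm)
      have "norm (mirror e c z - z) = 2 * d"
        using d by (simp add: mirror_def e d_def)
      moreover have "norm (mirror e c z - y) \<le> norm (mirror e c z - z) + norm (z - y)"
        by (rule norm_diff_triangle_ineq[of "mirror e c z" z z y, simplified])
      ultimately have up: "max (norm (z - y)) (norm (mirror e c z - y)) \<le> 5 / 2 * d"
        using n d by simp
      have "y \<bullet> e \<le> c"
        using norm_cauchy_schwarz[of "y - z" e] n e d
        by (simp add: inner_diff_left d_def norm_minus_commute)
      from norm_mirror_diff_ge[OF e this, of z]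
      have "0 < max (norm (z - y)) (norm (mirror e c z - y))"
        using d by (simp add: d_def)
      from k_mono[OF this up] True show ?thesis by (simp add: cross_kernel_def)
    qed (use cross_kernel_pos[OF e z, of y] in simp)
  qed (use integrable_cross_kernel[OF e z] in simp)
  finally show ?thesis .
qed

text \<open>The heart of the argument. Write \<open>a\<close> for the kernel between \<open>z\<close> and \<open>y\<close> and \<open>b \<le> a\<close> for the kernel
between \<open>z\<close> and the mirror image of \<open>y\<close>. As \<open>w\<close> is odd, the pair contributes
\<open>(w z - w y) a + (w z + w y) b = (w z - w y)(a - b) + 2 w(z) b\<close>, and minimality bounds \<open>w z - w y\<close> by
the difference of the bumps because \<open>a - b \<ge> 0\<close>. The bump terms with factor \<open>a\<close> are summed by
\<open>integral_bump_le\<close>; those with factor \<open>b\<close> are at most \<open>2 \<theta> b\<close>, as the bump has values in \<open>[0,1]\<close>.\<close>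

lemma minimum_inequality:
  fixes z x0 :: 'a
  assumes e: "norm e = 1" and z: "z \<bullet> e < c" and \<theta>: "0 < \<theta>"
    and min: "\<And>y. y \<bullet> e \<le> c \<Longrightarrow>
      refl_diff e c z - \<theta> * bump x0 z \<le> refl_diff e c y - \<theta> * bump x0 y"
  shows "g (u (mirror e c z)) - g (u z)
    \<le> \<theta> * kernel_weight + (refl_diff e c z + \<theta>) * (LINT y|lborel. cross_kernel e c z y)"
proof -
  let ?R = "mirror e c"
  let ?w = "refl_diff e c"
  let ?b = "cross_kernel e c z"
  define d where "d = c - z \<bullet> e"
  have d: "0 < d" using z by (simp add: d_def)
  have "continuous (at z) ?w"
    using continuous_on_refl_diff[of UNIV e c] by (simp add: continuous_on_eq_continuous_at)
  then obtain \<rho> where \<rho>: "0 < \<rho>" "\<And>y. dist y z < \<rho> \<Longrightarrow> dist (?w y) (?w z) < \<theta>"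
    using \<theta> unfolding continuous_at_eps_delta by blast
  have "eventually (\<lambda>\<epsilon>. (LINT y|lborel. indicat_real (- ball z \<epsilon>) y * ((?w z - ?w y) * k (norm (z - y))))
      \<le> \<theta> * kernel_weight + (?w z + \<theta>) * (LINT y|lborel. ?b y)) (at_right 0)"
  proof (rule eventually_mono)
    show "eventually (\<lambda>\<epsilon>. 0 < \<epsilon> \<and> \<epsilon> < min d \<rho>) (at_right (0::real))"
      using d \<rho>(1) unfolding eventually_at_right_field by (intro exI[of _ "min d \<rho>"]) auto
    fix \<epsilon> :: real assume \<epsilon>: "0 < \<epsilon> \<and> \<epsilon> < min d \<rho>"
    define F where "F y = indicat_real (- ball z \<epsilon>) y * ((?w z - ?w y) * k (norm (z - y)))" for y
    define T where "T y = indicat_real (- ball z \<epsilon>) y * ((bump x0 z - bump x0 y) * k (norm (z - y)))" for y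
    have iF: "integrable lborel F"
      unfolding F_def using \<epsilon> abs_refl_diff_le by (intro integrable_truncated_difference[where B = M]) auto
    have iT: "integrable lborel T"
      unfolding T_def using \<epsilon> bump_le_1[of x0] bump_nonneg[of x0]
      by (intro integrable_truncated_difference[where B = 1]) auto
    have ib: "integrable lborel ?b" by (rule integrable_cross_kernel[OF e z])
    have "(LINT y|lborel. F y) \<le> (LINT y|lborel. \<theta> * T y + (?w z + \<theta>) * ?b y)"
    proof (rule integral_symmetrised_le[OF e iF])
      show "integrable lborel (\<lambda>y. \<theta> * T y + (?w z + \<theta>) * ?b y)" using iT ib by simp
      fix y :: 'a assume y: "y \<bullet> e \<le> c"
      let ?a = "k (norm (z - y))" and ?a' = "k (norm (?R z - y))"
      have R1: "norm (z - ?R y) = norm (?R z - y)" by (rule norm_diff_mirror[OF e])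
      have R2: "norm (?R z - ?R y) = norm (z - y)"
        using dist_mirror[OF e, of c z y] by (simp add: dist_norm)
      have le: "norm (z - y) \<le> norm (?R z - y)" using norm_diff_le_mirror[OF e _ y] z by simp
      have far: "d \<le> norm (?R z - y)" using norm_mirror_diff_ge[OF e y] by (simp add: d_def)
      have out: "?R y \<notin> ball z \<epsilon>" using far \<epsilon> R1 by (simp add: dist_norm)
      have b: "?b y = ?a'" "?b (?R y) = ?a'"
        using le by (simp_all add: cross_kernel_def R1 R2 max_def)
      have pos: "0 < ?a'" using far d by (intro k_pos) linarith
      have F': "F (?R y) = (?w z + ?w y) * ?a'"
        using out by (simp add: F_def R1 refl_diff_mirror[OF e])
      have T': "T (?R y) = (bump x0 z - bump x0 (?R y)) * ?a'"
        using out by (simp add: T_def R1)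
      note bb = bump_nonneg[of x0 z] bump_le_1[of x0 y] bump_le_1[of x0 "?R y"]
      show "F y + F (?R y) \<le> (\<theta> * T y + (?w z + \<theta>) * ?b y) + (\<theta> * T (?R y) + (?w z + \<theta>) * ?b (?R y))"
      \<comment> \<open>Inside the excluded ball only the mirror point contributes, and continuity of \<open>w\<close> at \<open>z\<close> replaces minimality.\<close>
      proof (cases "y \<in> ball z \<epsilon>")
        case True
        then have "dist y z < \<rho>" using \<epsilon> by (simp add: dist_commute)
        from \<rho>(2)[OF this] have "?w y \<le> ?w z + \<theta>" by (simp add: dist_real_def)
        moreover have "\<theta> * bump x0 (?R y) \<le> \<theta>" "0 \<le> \<theta> * bump x0 z" using bb \<theta> by auto
        ultimately have "0 \<le> (\<theta> * (bump x0 z - bump x0 (?R y)) + 2 * (?w z + \<theta>) - (?w z + ?w y)) * ?a'"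
          using pos by (intro mult_nonneg_nonneg) (auto simp: algebra_simps)
        then show ?thesis using True unfolding F' T' b by (simp add: F_def T_def algebra_simps)
      next
        case False
        have "0 < norm (z - y)" using False \<epsilon> by (auto simp: dist_norm)
        then have "?a' \<le> ?a" using le by (rule k_mono)
        then have 1: "0 \<le> (\<theta> * (bump x0 z - bump x0 y) - (?w z - ?w y)) * (?a - ?a')"
          using min[OF y] by (intro mult_nonneg_nonneg) (auto simp: algebra_simps)
        have "0 \<le> (\<theta> * ((1 - bump x0 y) + (1 - bump x0 (?R y)) + 2 * bump x0 z)) * ?a'"
          using bb \<theta> pos by (intro mult_nonneg_nonneg) auto
        with 1 show ?thesis using False unfolding F' T' b by (simp add: F_def T_def algebra_simps)
      qed
    qed
    also have "\<dots> = \<theta> * (LINT y|lborel. T y) + (?w z + \<theta>) * (LINT y|lborel. ?b y)"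
      using iT ib by simp
    also have "\<dots> \<le> \<theta> * kernel_weight + (?w z + \<theta>) * (LINT y|lborel. ?b y)"
      using integral_bump_le[of \<epsilon> z x0] \<epsilon> \<theta> by (simp add: T_def)
    finally show "(LINT y|lborel. indicat_real (- ball z \<epsilon>) y * ((?w z - ?w y) * k (norm (z - y))))
      \<le> \<theta> * kernel_weight + (?w z + \<theta>) * (LINT y|lborel. ?b y)" by (simp add: F_def)
  qed
  with tendsto_truncated_refl_diff[OF e, of z c] show ?thesis
    by (intro tendsto_upperbound) auto
qed

section \<open>Minimum principles\<close>

lemma cross_kernel_integral_large:
  obtains \<delta> where "0 < \<delta>"
    "\<And>e z c. norm e = 1 \<Longrightarrow> z \<bullet> e < c \<Longrightarrow> c - z \<bullet> e < \<delta> \<Longrightarrow>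
        B \<le> (LINT y|lborel. cross_kernel e c z y)"
proof -
  let ?N = "DIM('a)"
  let ?V = "unit_ball_vol (real ?N)"
  have V: "0 < ?V" by simp
  from k_sing have "eventually (\<lambda>r. B * 5 ^ ?N / ?V \<le> r ^ ?N * k r) (at_right 0)"
    by (auto simp: filterlim_at_top)
  then obtain r0 where r0: "0 < r0" "\<And>r. 0 < r \<Longrightarrow> r < r0 \<Longrightarrow> B * 5 ^ ?N / ?V \<le> r ^ ?N * k r"
    unfolding eventually_at_right_field by auto
  show thesis
  proof
    show "0 < 2 / 5 * r0" using r0 by simp
    fix e z :: 'a and c assume e: "norm e = 1" and z: "z \<bullet> e < c" and d: "c - z \<bullet> e < 2 / 5 * r0"
    define d where "d = c - z \<bullet> e"
    have "B * 5 ^ ?N / ?V \<le> (5 / 2 * d) ^ ?N * k (5 / 2 * d)"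
      using z d by (intro r0(2)) (auto simp: d_def)
    also have "(5 / 2 * d) ^ ?N = 5 ^ ?N * (d / 2) ^ ?N"
      by (simp add: power_mult_distrib[symmetric])
    finally have "B / ?V \<le> (d / 2) ^ ?N * k (5 / 2 * d)"
      by (simp add: field_simps)
    then have "B \<le> ?V * (d / 2) ^ ?N * k (5 / 2 * d)"
      using V by (simp add: pos_divide_le_eq mult_ac)
    also have "\<dots> \<le> (LINT y|lborel. cross_kernel e c z y)"
      using cross_kernel_integral_ge[OF e z] by (simp add: d_def)
    finally show "B \<le> (LINT y|lborel. cross_kernel e c z y)" .
  qed
qed

definition reflection_increases :: "'a \<Rightarrow> real \<Rightarrow> bool" where
  "reflection_increases e c \<longleftrightarrow> (\<forall>y. y \<bullet> e \<le> c \<longrightarrow> 0 \<le> refl_diff e c y)"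

text \<open>One \<open>\<delta>\<close> serves all directions and all planes, which allows the plane to be pushed
past a given position. Points with \<open>u z \<le> \<l>\<close> include a neighbourhood of infinity; points with \<open>c - z \<bullet> e < \<delta>\<close>
form a strip along the plane.\<close>

lemma minimum_principle:
  obtains \<delta> where "0 < \<delta>"
    "\<And>e c. norm e = 1 \<Longrightarrow>
      (\<And>z. z \<bullet> e < c \<Longrightarrow> refl_diff e c z < 0 \<Longrightarrow> u z \<le> \<l> \<or> c - z \<bullet> e < \<delta>) \<Longrightarrow> reflection_increases e c"
proof -
  define L where "L = max 0 \<Lambda>"
  obtain \<delta> where \<delta>: "0 < \<delta>" "\<And>e z c. norm e = 1 \<Longrightarrow> z \<bullet> e < c \<Longrightarrow> c - z \<bullet> e < \<delta> \<Longrightarrow>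
        2 * L + 2 \<le> (LINT y|lborel. cross_kernel e c z y)"
    using cross_kernel_integral_large by metis
  show thesis
  proof (rule that[OF \<delta>(1)])
    fix e c assume e: "norm e = 1"
      and small: "\<And>z. z \<bullet> e < c \<Longrightarrow> refl_diff e c z < 0 \<Longrightarrow> u z \<le> \<l> \<or> c - z \<bullet> e < \<delta>"
    let ?w = "refl_diff e c"
    define H where "H = {y. y \<bullet> e \<le> c}"
    have bdd: "bdd_below (?w ` H)"
      using abs_refl_diff_le[of e c] by (intro bdd_belowI2[of _ "- M"]) (metis abs_le_D2 minus_le_iff)
    show "reflection_increases e c"
    proof (rule ccontr)
      assume "\<not> reflection_increases e c"
      then obtain y0 where y0: "y0 \<in> H" "?w y0 < 0" by (auto simp: reflection_increases_def H_def not_le)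
      define A where "A = - (INF y\<in>H. ?w y)"
      have A: "0 < A" using cINF_lower[OF bdd y0(1)] y0(2) by (simp add: A_def)
      have wA: "- A \<le> ?w y" if "y \<in> H" for y using cINF_lower[OF bdd that] by (simp add: A_def)
      \<comment> \<open>The choice of \<open>\<eta>\<close> makes the error \<open>2 \<eta> kernel_weight\<close> smaller than both \<open>\<gamma> A / 2\<close> and \<open>A\<close>,
the gains in the two cases, and gives \<open>w z + 2 \<eta> \<le> - A / 2\<close>.\<close>
      define q where "q = min (\<gamma> / 2) 1"
      have q: "0 < q" "q \<le> \<gamma> / 2" "q \<le> 1" using \<gamma>_pos by (auto simp: q_def)
      define \<eta> where "\<eta> = min (A / 6) (q * A / (4 * (kernel_weight + 1)))"
      have \<eta>: "0 < \<eta>" using A q kernel_weight_nonneg by (simp add: \<eta>_def)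
      have \<eta>6: "\<eta> \<le> A / 6" unfolding \<eta>_def by (rule min.cobounded1)
      have "\<eta> * (4 * (kernel_weight + 1)) \<le> q * A"
        using kernel_weight_nonneg by (simp add: \<eta>_def pos_le_divide_eq[symmetric])
      then have \<eta>C: "2 * \<eta> * kernel_weight < q * A"
      proof -
        have "\<eta> * (4 * (kernel_weight + 1)) = 4 * (\<eta> * kernel_weight) + 4 * \<eta>" by (simp add: algebra_simps)
        moreover have "0 \<le> \<eta> * kernel_weight" using \<eta> kernel_weight_nonneg by simp
        ultimately show ?thesis using \<open>\<eta> * (4 * (kernel_weight + 1)) \<le> q * A\<close> \<eta> by simp
      qed
      have "(INF y\<in>H. ?w y) < - A + \<eta>" using \<eta> by (simp add: A_def)
      then obtain x0 where x0: "x0 \<in> H" "?w x0 < - A + \<eta>"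
        using y0 bdd by (subst (asm) cINF_less_iff) auto
      define v where "v y = ?w y - 2 * \<eta> * bump x0 y" for y
      have "compact (H \<inter> cball x0 1)"
        unfolding H_def inner_commute[of _ e] by (intro closed_Int_compact closed_halfspace_le) auto
      moreover have "H \<inter> cball x0 1 \<noteq> {}" using x0 by auto
      moreover have "continuous_on (H \<inter> cball x0 1) v"
        unfolding v_def by (intro continuous_intros continuous_on_refl_diff continuous_on_bump)
      ultimately obtain z where z: "z \<in> H" "\<And>y. y \<in> H \<inter> cball x0 1 \<Longrightarrow> v z \<le> v y"
        using continuous_attains_inf[of "H \<inter> cball x0 1" v] by blast
      \<comment> \<open>The bump lowers the value at \<open>x0\<close> below the infimum \<open>- A\<close>, so the minimum over the unit ball is global.\<close>
      have vz: "v z < - A - \<eta>"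
        using z(2)[of x0] x0 by (simp add: v_def bump_center)
      have min: "v z \<le> v y" if "y \<in> H" for y
      proof (cases "y \<in> cball x0 1")
        case False
        then show ?thesis using vz wA[OF that] \<eta> by (simp add: v_def bump_outside del: mem_cball)
      qed (use z that in auto)
      have wz: "?w z < - A + \<eta>"
        using vz mult_left_le[OF bump_le_1[of x0 z], of "2 * \<eta>"] \<eta> unfolding v_def by linarith
      then have wz0: "?w z < 0" using \<eta>6 A by simp
      have ze: "z \<bullet> e < c"
        using z(1) wz0 refl_diff_plane[of z e c] by (cases "z \<bullet> e = c") (auto simp: H_def)
      define G where "G = (LINT y|lborel. cross_kernel e c z y)"
      have G0: "0 \<le> G"
        unfolding G_def using cross_kernel_pos[OF e ze] by (intro integral_nonneg_AE) (auto simp: less_imp_le)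
      have main: "g (u (mirror e c z)) - g (u z) \<le> 2 * \<eta> * kernel_weight + (?w z + 2 * \<eta>) * G"
        unfolding G_def
        by (rule minimum_inequality[OF e ze]) (use \<eta> min in \<open>auto simp: v_def H_def\<close>)
      have "(?w z + 2 * \<eta>) * G \<le> - (A / 2) * G"
        using wz \<eta>6 G0 by (intro mult_right_mono) auto
      with main have main': "g (u (mirror e c z)) - g (u z) \<le> 2 * \<eta> * kernel_weight - (A / 2) * G" by simp
      have lt: "u (mirror e c z) \<le> u z" using wz0 by (simp add: refl_diff_def)
      have diff: "u z - u (mirror e c z) = - ?w z" by (simp add: refl_diff_def)
      show False
        using small[OF ze wz0]
      proof
        assume "u z \<le> \<l>"
        from g_decr[OF u_nonneg lt this]
        have "\<gamma> * (- ?w z) \<le> g (u (mirror e c z)) - g (u z)" by (simp add: diff)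
        also have "\<dots> < q * A"
        proof -
          have "0 \<le> (A / 2) * G" using A G0 by simp
          then show ?thesis using main' \<eta>C by linarith
        qed
        also have "\<dots> \<le> (\<gamma> / 2) * A" using q A by (intro mult_right_mono) auto
        also have "\<dots> = \<gamma> * (A / 2)" by simp
        also have "\<dots> \<le> \<gamma> * (- ?w z)" using wz \<eta>6 \<gamma>_pos A by (intro mult_left_mono) linarith+
        finally show False by simp
      next
        assume "c - z \<bullet> e < \<delta>"
        from \<delta>(2)[OF e ze this] have "2 * L + 2 \<le> G" by (simp add: G_def)
        then have "(A / 2) * (2 * L + 2) \<le> (A / 2) * G" using A by (intro mult_left_mono) auto
        moreover have "g (u z) - g (u (mirror e c z)) \<le> L * A"
        proof -
          have "g (u z) - g (u (mirror e c z)) \<le> \<Lambda> * (- ?w z)"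
            using g_lip[OF u_nonneg lt u_le] by (simp add: diff)
          also have "\<dots> \<le> L * (- ?w z)" using wz0 by (intro mult_right_mono) (auto simp: L_def)
          also have "\<dots> \<le> L * A" using wA[OF z(1)] by (intro mult_left_mono) (auto simp: L_def)
          finally show ?thesis .
        qed
        moreover have "q * A \<le> A" using q A by simp
        ultimately show False using main' \<eta>C by (simp add: algebra_simps)
      qed
    qed
  qed
qed

text \<open>At an interior zero of \<open>w \<ge> 0\<close> the two equations agree, so the limit of the truncated integrals is 0. But each pair of mirror
points outside the excluded ball contributes \<open>- w(y)(a - b) \<le> 0\<close>, and a fixed ball around a point where \<open>w > 0\<close>
contributes a definite negative amount, whereas the mirror image of the excluded ball contributes only \<open>O(\<epsilon>\<^sup>N)\<close>.\<close>

lemma strong_minimum_principle: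
  assumes e: "norm e = 1" and incr: "reflection_increases e c"
    and z: "z \<bullet> e < c" "refl_diff e c z = 0" and y0: "y0 \<bullet> e \<le> c"
  shows "refl_diff e c y0 = 0"
proof (rule ccontr)
  let ?R = "mirror e c"
  let ?w = "refl_diff e c"
  let ?V = "unit_ball_vol (real DIM('a))"
  assume "?w y0 \<noteq> 0"
  then have w0: "0 < ?w y0" using incr y0 by (auto simp: reflection_increases_def order_less_le)
  then have y0e: "y0 \<bullet> e < c" using refl_diff_plane[of y0 e c] y0 by (cases "y0 \<bullet> e = c") auto
  define d where "d = c - z \<bullet> e"
  have d: "0 < d" using z by (simp add: d_def)
  have yz: "y0 \<noteq> z" using w0 z by auto
  define r1 where "r1 = norm (z - y0)"
  define r2 where "r2 = norm (?R z - y0)"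
  have r1: "0 < r1" using yz by (simp add: r1_def)
  have r12: "r1 < r2" unfolding r1_def r2_def by (rule norm_diff_less_mirror[OF e z(1) y0e])
  have "continuous (at y0) ?w"
    using continuous_on_refl_diff[of UNIV e c] by (simp add: continuous_on_eq_continuous_at)
  then obtain \<sigma> where \<sigma>: "0 < \<sigma>" "\<And>y. dist y y0 < \<sigma> \<Longrightarrow> dist (?w y) (?w y0) < ?w y0 / 2"
    using w0 unfolding continuous_at_eps_delta by (metis half_gt_zero)
  \<comment> \<open>The radius is chosen so small that on the ball around \<open>y0\<close> the value of \<open>w\<close> is at least half of \<open>w y0\<close>, the
ball stays in the open half-space and away from \<open>z\<close>, and distances to \<open>z\<close> and to its mirror image stay separated.\<close>
  define \<rho> where "\<rho> = min (min \<sigma> (c - y0 \<bullet> e)) (min (r1 / 2) ((r2 - r1) / 4))"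
  have "0 < \<rho> \<and> \<rho> \<le> \<sigma> \<and> \<rho> \<le> c - y0 \<bullet> e \<and> \<rho> \<le> r1 / 2 \<and> \<rho> \<le> (r2 - r1) / 4"
    using \<sigma>(1) y0e r1 r12 by (auto simp: \<rho>_def min_def)
  then have \<rho>: "0 < \<rho>" "\<rho> \<le> \<sigma>" "\<rho> \<le> c - y0 \<bullet> e" "\<rho> \<le> r1 / 2" "\<rho> \<le> (r2 - r1) / 4"
    by blast+
  define \<beta> where "\<beta> = ?w y0 / 2 * (k (r1 + \<rho>) - k (r2 - \<rho>))"
  have kk: "0 < k (r1 + \<rho>) - k (r2 - \<rho>)"
    using k_strict[of "r1 + \<rho>" "r2 - \<rho>"] r1 r12 \<rho> by simp
  then have \<beta>: "0 < \<beta>" using w0 by (simp add: \<beta>_def)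
  have le: "eventually (\<lambda>\<epsilon>. (LINT y|lborel. indicat_real (- ball z \<epsilon>) y * ((?w z - ?w y) * k (norm (z - y))))
      \<le> - \<beta> * (?V * \<rho> ^ DIM('a)) + M * k d * (?V * \<epsilon> ^ DIM('a))) (at_right 0)"
  proof (rule eventually_mono)
    show "eventually (\<lambda>\<epsilon>. 0 < \<epsilon> \<and> \<epsilon> < min d \<rho>) (at_right (0::real))"
      using d \<rho>(1) unfolding eventually_at_right_field by (intro exI[of _ "min d \<rho>"]) auto
    fix \<epsilon> :: real assume \<epsilon>: "0 < \<epsilon> \<and> \<epsilon> < min d \<rho>"
    define F where "F y = indicat_real (- ball z \<epsilon>) y * ((?w z - ?w y) * k (norm (z - y)))" for y
    define P where "P y = - \<beta> * indicat_real (ball y0 \<rho>) y + M * k d * indicat_real (ball z \<epsilon>) y" for y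
    have iF: "integrable lborel F"
      unfolding F_def using \<epsilon> abs_refl_diff_le by (intro integrable_truncated_difference[where B = M]) auto
    have ib: "integrable lborel (indicat_real (ball x r))" if "0 < r" for x :: 'a and r
      by (rule integrable_real_indicator) (use that in \<open>auto simp: emeasure_ball\<close>)
    have "(LINT y|lborel. F y) \<le> (LINT y|lborel. P y)"
    proof (rule integral_symmetrised_le[OF e iF])
      show "integrable lborel P"
        unfolding P_def using ib \<epsilon> \<rho> by (intro Bochner_Integration.integrable_add integrable_mult_right) auto
      fix y :: 'a assume y: "y \<bullet> e \<le> c"
      let ?a = "k (norm (z - y))" and ?a' = "k (norm (?R z - y))"
      have R1: "norm (z - ?R y) = norm (?R z - y)" by (rule norm_diff_mirror[OF e])
      have far: "d \<le> norm (?R z - y)" using norm_mirror_diff_ge[OF e y] by (simp add: d_def)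
      have pos: "0 < ?a'" using far d by (intro k_pos) linarith
      have wy: "0 \<le> ?w y" using incr y by (simp add: reflection_increases_def)
      have out: "?R y \<notin> ball z \<epsilon>" using far \<epsilon> R1 by (simp add: dist_norm)
      have inside: "x \<bullet> e < c" if "x \<in> ball y0 \<rho>" for x
      proof -
        have "(x - y0) \<bullet> e \<le> norm (x - y0)" using norm_cauchy_schwarz[of "x - y0" e] e by simp
        also have "\<dots> < \<rho>" using that by (simp add: dist_norm norm_minus_commute)
        finally show ?thesis using \<rho> by (simp add: inner_diff_left)
      qed
      have out': "?R y \<notin> ball y0 \<rho>"
        using inside[of "?R y"] y by (auto simp: inner_mirror[OF e])
      have F': "F (?R y) = ?w y * ?a'"
        using out by (simp add: F_def R1 refl_diff_mirror[OF e] z)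
      have P': "P (?R y) = 0" using out out' by (simp add: P_def)
      show "F y + F (?R y) \<le> P y + P (?R y)"
      proof (cases "y \<in> ball z \<epsilon>")
        case True
        have "y \<notin> ball y0 \<rho>"
        proof
          assume "y \<in> ball y0 \<rho>"
          then have "dist y0 z < \<rho> + \<epsilon>" using True dist_triangle[of y0 z y] by (simp add: dist_commute)
          then show False using \<rho> \<epsilon> by (simp add: r1_def dist_norm norm_minus_commute)
        qed
        moreover have "?w y * ?a' \<le> M * k d"
          using abs_refl_diff_le[of e c y] k_mono[OF d far] pos wy
          by (intro mult_mono) auto
        ultimately show ?thesis using True unfolding F' P' by (simp add: F_def P_def)
      next
        case False
        have Fsum: "F y + F (?R y) = - (?w y * (?a - ?a'))"
          using False unfolding F' by (simp add: F_def z algebra_simps)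
        show ?thesis
        proof (cases "y \<in> ball y0 \<rho>")
          case True
          then have near: "norm (y0 - y) < \<rho>" by (simp add: dist_norm)
          have "norm (z - y) \<le> r1 + \<rho>"
            using norm_triangle_ineq[of "z - y0" "y0 - y"] near by (simp add: r1_def)
          moreover have "0 < norm (z - y)" using False \<epsilon> by (auto simp: dist_norm)
          ultimately have 1: "k (r1 + \<rho>) \<le> ?a" by (intro k_mono)
          have "r2 - \<rho> \<le> norm (?R z - y)"
            using norm_triangle_ineq[of "?R z - y" "y - y0"] near by (simp add: r2_def norm_minus_commute)
          then have 2: "?a' \<le> k (r2 - \<rho>)" using \<rho> r1 r12 by (intro k_mono) auto
          have "dist y y0 < \<sigma>" using near \<rho> by (simp add: dist_norm norm_minus_commute)
          from \<sigma>(2)[OF this] have "?w y0 / 2 \<le> ?w y" by (simp add: dist_real_def abs_if split: if_splits)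
          then have "\<beta> \<le> ?w y * (?a - ?a')"
            unfolding \<beta>_def using 1 2 kk wy w0 by (intro mult_mono) auto
          then show ?thesis using True False unfolding Fsum P' by (simp add: P_def)
        next
          case 3: False
          have "0 < norm (z - y)" using False \<epsilon> by (auto simp: dist_norm)
          then have "?a' \<le> ?a" using norm_diff_le_mirror[OF e _ y] z by (intro k_mono) auto
          then have "0 \<le> ?w y * (?a - ?a')" using wy by simp
          then show ?thesis using 3 False unfolding Fsum P' by (simp add: P_def)
        qed
      qed
    qed
    also have "\<dots> = - \<beta> * (?V * \<rho> ^ DIM('a)) + M * k d * (?V * \<epsilon> ^ DIM('a))"
    proof -
      have "(LINT y|lborel. indicat_real (ball x r) y) = ?V * r ^ DIM('a)" if "0 < r" for x :: 'a and r
        using that by (simp add: content_ball)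
      moreover have "(LINT y|lborel. P y) =
          (LINT y|lborel. - \<beta> * indicat_real (ball y0 \<rho>) y) + (LINT y|lborel. M * k d * indicat_real (ball z \<epsilon>) y)"
        unfolding P_def using ib \<epsilon> \<rho>
        by (intro Bochner_Integration.integral_add integrable_mult_right) auto
      ultimately show ?thesis using \<epsilon> \<rho> by simp
    qed
    finally show "(LINT y|lborel. indicat_real (- ball z \<epsilon>) y * ((?w z - ?w y) * k (norm (z - y))))
      \<le> - \<beta> * (?V * \<rho> ^ DIM('a)) + M * k d * (?V * \<epsilon> ^ DIM('a))" by (simp add: F_def)
  qed
  have "((\<lambda>\<epsilon>. - \<beta> * (?V * \<rho> ^ DIM('a)) + M * k d * (?V * \<epsilon> ^ DIM('a))) \<longlongrightarrow>
      - \<beta> * (?V * \<rho> ^ DIM('a)) + M * k d * (?V * 0 ^ DIM('a))) (at_right 0)"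
    by (intro tendsto_intros)
  from tendsto_le[OF _ this tendsto_truncated_refl_diff[OF e] le]
  have "g (u (?R z)) - g (u z) \<le> - \<beta> * (?V * \<rho> ^ DIM('a))" by (simp add: zero_power)
  moreover have "u (?R z) = u z" using z by (simp add: refl_diff_def)
  moreover have "0 < \<beta> * (?V * \<rho> ^ DIM('a))" using \<beta> \<rho> by simp
  ultimately show False by simp
qed

section \<open>Moving planes\<close>

text \<open>The plane is moved in direction \<open>e\<close> as long as the reflection does not decrease \<open>u\<close> on the half-space
behind it. A point with \<open>u xs > \<l>\<close> stops the motion, since it must not be reflected into the region where \<open>u \<le> \<l>\<close>.\<close>

lemma exists_symmetry_plane:
  assumes e: "norm e = 1" and xs: "\<l> < u xs"
  obtains c where "\<And>x. u (mirror e c x) = u x" "\<And>c'. c' \<le> c \<Longrightarrow> reflection_increases e c'"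
proof -
  obtain \<delta> where \<delta>: "0 < \<delta>" "\<And>c. 
      (\<And>z. z \<bullet> e < c \<Longrightarrow> refl_diff e c z < 0 \<Longrightarrow> u z \<le> \<l> \<or> c - z \<bullet> e < \<delta>) \<Longrightarrow> reflection_increases e c"
    using minimum_principle e by metis
  obtain R where R: "\<And>x. R \<le> norm x \<Longrightarrow> u x \<le> \<l>"
    using u_far by (auto simp: eventually_at_infinity)
  have ne: "\<bar>x \<bullet> e\<bar> \<le> norm x" for x
    using Cauchy_Schwarz_ineq2[of x e] e by simp
  define S where "S = {c. \<forall>c'\<le>c. reflection_increases e c'}"
  have far: "reflection_increases e c" if "c \<le> - R" for c
  proof (rule \<delta>(2))
    fix z assume "z \<bullet> e < c"
    then have "R \<le> norm z" using ne[of z] that by linarith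
    then show "u z \<le> \<l> \<or> c - z \<bullet> e < \<delta>" using R by auto
  qed
  have S1: "- R \<in> S" using far by (auto simp: S_def)
  have bd: "c \<le> max (xs \<bullet> e) ((R + xs \<bullet> e) / 2)" if "c \<in> S" for c
  proof (rule ccontr)
    assume "\<not> c \<le> max (xs \<bullet> e) ((R + xs \<bullet> e) / 2)"
    then have c: "xs \<bullet> e < c" "R + xs \<bullet> e < 2 * c" by (simp_all add: not_le)
    have "R \<le> norm (mirror e c xs)"
      using ne[of "mirror e c xs"] c by (simp add: inner_mirror e)
    then have "u (mirror e c xs) \<le> \<l>" by (rule R)
    moreover have "0 \<le> refl_diff e c xs" using that c by (auto simp: S_def reflection_increases_def)
    ultimately show False using xs by (simp add: refl_diff_def)
  qed
  have bdd: "bdd_above S" using bd by (rule bdd_aboveI)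
  define c0 where "c0 = Sup S"
  have below: "reflection_increases e c" if "c < c0" for c
  proof -
    obtain c' where "c' \<in> S" "c < c'" using \<open>c < c0\<close> S1 bdd less_cSup_iff unfolding c0_def by blast
    then show ?thesis by (auto simp: S_def)
  qed
  have cont_c: "continuous_on UNIV (\<lambda>c. refl_diff e c y)" for y
    unfolding refl_diff_def mirror_def
    by (intro continuous_intros continuous_on_compose2[OF u_cont]) auto
  have incr0: "reflection_increases e c0"
    unfolding reflection_increases_def
  proof (intro allI impI)
    fix y assume "y \<bullet> e \<le> c0"
    show "0 \<le> refl_diff e c0 y"
    proof (cases "y \<bullet> e = c0")
      case True
      then show ?thesis by (simp add: refl_diff_plane)
    next
      case False
      then have lt: "y \<bullet> e < c0" using \<open>y \<bullet> e \<le> c0\<close> by simp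
      have "isCont (\<lambda>c. refl_diff e c y) c0"
        using cont_c by (simp add: continuous_on_eq_continuous_at)
      then have "((\<lambda>c. refl_diff e c y) \<longlongrightarrow> refl_diff e c0 y) (at_left c0)"
        unfolding isCont_def by (rule tendsto_within_subset) simp
      moreover have "eventually (\<lambda>c. 0 \<le> refl_diff e c y) (at_left c0)"
        unfolding eventually_at_left_field
        using lt below by (intro exI[of _ "y \<bullet> e"]) (auto simp: reflection_increases_def)
      ultimately show ?thesis by (rule tendsto_lowerbound) simp
    qed
  qed
  have zero: "refl_diff e c0 x = 0" if "x \<bullet> e \<le> c0" for x
  proof (rule ccontr)
    assume nz: "refl_diff e c0 x \<noteq> 0"
    have pos: "0 < refl_diff e c0 y" if "y \<bullet> e < c0" for y
      using strong_minimum_principle[OF e incr0 that _ \<open>x \<bullet> e \<le> c0\<close>] nz incr0 that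
      by (auto simp: reflection_increases_def order_less_le)
    \<comment> \<open>A point outside \<open>K\<close> behind a plane slightly beyond \<open>c0\<close> either is far from the origin or lies in the strip
of width \<open>\<delta>\<close>, so the minimum principle only has to be supplemented by positivity on \<open>K\<close>.\<close>
    define K where "K = {y. y \<bullet> e \<le> c0 - \<delta> / 2} \<inter> cball 0 R"
    have K: "compact K"
      unfolding K_def inner_commute[of _ e] by (intro closed_Int_compact closed_halfspace_le) auto
    have "\<exists>\<eta>>0. \<forall>c y. c0 \<le> c \<longrightarrow> c < c0 + \<eta> \<longrightarrow> y \<in> K \<longrightarrow> 0 < refl_diff e c y"
    proof (cases "K = {}")
      case False
      then obtain y0 where y0: "y0 \<in> K" "\<And>y. y \<in> K \<Longrightarrow> refl_diff e c0 y0 \<le> refl_diff e c0 y"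
        using continuous_attains_inf[OF K _ continuous_on_refl_diff] by blast
      define \<mu> where "\<mu> = refl_diff e c0 y0"
      have \<mu>: "0 < \<mu>" unfolding \<mu>_def using y0(1) \<delta>(1) by (intro pos) (auto simp: K_def)
      define h where "h p = refl_diff e (fst p) (snd p)" for p
      have "continuous_on ({c0..c0 + 1} \<times> K) h"
        unfolding h_def refl_diff_def mirror_def
        by (intro continuous_intros continuous_on_compose2[OF u_cont]) auto
      then have "uniformly_continuous_on ({c0..c0 + 1} \<times> K) h"
        using K by (intro compact_uniformly_continuous compact_Times) auto
      then obtain d where d: "0 < d" "\<And>p q. p \<in> {c0..c0 + 1} \<times> K \<Longrightarrow> q \<in> {c0..c0 + 1} \<times> K \<Longrightarrow>
          dist q p < d \<Longrightarrow> dist (h q) (h p) < \<mu>"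
        using \<mu> unfolding uniformly_continuous_on_def by metis
      show ?thesis
      proof (intro exI[of _ "min 1 d"] conjI allI impI)
        fix c y assume c: "c0 \<le> c" "c < c0 + min 1 d" and y: "y \<in> K"
        have "dist (h (c, y)) (h (c0, y)) < \<mu>"
          using c y by (intro d(2)) (auto simp: dist_Pair_Pair dist_real_def)
        moreover have "\<mu> \<le> h (c0, y)" using y0(2)[OF y] by (simp add: h_def \<mu>_def)
        ultimately show "0 < refl_diff e c y" by (simp add: h_def dist_real_def)
      qed (use d in auto)
    qed (auto intro: exI[of _ 1])
    then obtain \<eta> where \<eta>: "0 < \<eta>" "\<And>c y. c0 \<le> c \<Longrightarrow> c < c0 + \<eta> \<Longrightarrow> y \<in> K \<Longrightarrow> 0 < refl_diff e c y"
      by blast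
    have above: "reflection_increases e c" if c: "c0 \<le> c" "c < c0 + min \<eta> (\<delta> / 2)" for c
    proof (rule \<delta>(2))
      have "min \<eta> (\<delta> / 2) \<le> \<eta>" "min \<eta> (\<delta> / 2) \<le> \<delta> / 2" by simp_all
      with c have c': "c < c0 + \<eta>" "c < c0 + \<delta> / 2" by linarith+
      fix z assume z: "z \<bullet> e < c" "refl_diff e c z < 0"
      then have "z \<notin> K" using \<eta>(2)[of c z] c(1) c'(1) by auto
      then show "u z \<le> \<l> \<or> c - z \<bullet> e < \<delta>" using c'(2) R[of z] by (auto simp: K_def)
    qed
    have "c0 + min \<eta> (\<delta> / 2) / 2 \<in> S"
      unfolding S_def
    proof (intro CollectI allI impI)
      fix c assume c: "c \<le> c0 + min \<eta> (\<delta> / 2) / 2"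
      have "0 < min \<eta> (\<delta> / 2)" using \<eta> \<delta> by simp
      with c have "c < c0 + min \<eta> (\<delta> / 2)" by linarith
      then show "reflection_increases e c" using below[of c] above[of c] by (cases "c < c0") auto
    qed
    then have "c0 + min \<eta> (\<delta> / 2) / 2 \<le> c0" unfolding c0_def using bdd by (rule cSup_upper)
    then show False using \<eta> \<delta> by simp
  qed
  show thesis
  proof
    fix x
    show "u (mirror e c0 x) = u x"
    proof (cases "x \<bullet> e \<le> c0")
      case True
      from zero[OF this] show ?thesis by (simp add: refl_diff_def)
    next
      case False
      then have "mirror e c0 x \<bullet> e \<le> c0" by (simp add: inner_mirror e)
      from zero[OF this] show ?thesis by (simp add: refl_diff_def mirror_mirror e)
    qed
  next
    show "reflection_increases e c'" if "c' \<le> c0" for c' using that below incr0 by (cases "c' = c0") auto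
  qed
qed

lemma mirror_bisector:
  fixes x y :: 'a
  assumes "x \<noteq> y"
  defines "e \<equiv> (y - x) /\<^sub>R norm (y - x)"
  shows "mirror e ((x + y) \<bullet> e / 2) x = y" "norm e = 1" "x \<bullet> e < (x + y) \<bullet> e / 2"
proof -
  have n: "norm (y - x) \<noteq> 0" using assms by simp
  show 1: "norm e = 1" using n by (simp add: e_def)
  have "(y - x) \<bullet> e = norm (y - x)"
    using n by (simp add: e_def inner_scaleR_right dot_square_norm power2_eq_square)
  then have d: "y \<bullet> e = x \<bullet> e + norm (y - x)" by (simp add: inner_diff_left)
  have ne: "norm (y - x) *\<^sub>R e = y - x" using n by (simp add: e_def)
  have "mirror e ((x + y) \<bullet> e / 2) x = x + norm (y - x) *\<^sub>R e"
  proof -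
    have "2 * (x \<bullet> e - (x + y) \<bullet> e / 2) = - norm (y - x)" by (simp add: inner_add_left d field_simps)
    then show ?thesis by (simp add: mirror_def)
  qed
  then show "mirror e ((x + y) \<bullet> e / 2) x = y" by (simp add: ne)
  show "x \<bullet> e < (x + y) \<bullet> e / 2" using n by (simp add: inner_add_left d)
qed

text \<open>Any two distinct points are mirror images of each other, and without points above \<open>\<l>\<close> the minimum principle applies
to every plane in both orientations.\<close>

lemma constant_if_small:
  assumes "\<And>x. u x \<le> \<l>"
  shows "u x = u y"
proof -
  have "u x \<le> u y" if "x \<noteq> y" for x y
  proof -
    note b = mirror_bisector[OF that]
    have "reflection_increases ((y - x) /\<^sub>R norm (y - x)) c" for c
      using minimum_principle b(2) assms by metis
    with b(3) have "0 \<le> refl_diff ((y - x) /\<^sub>R norm (y - x)) ((x + y) \<bullet> ((y - x) /\<^sub>R norm (y - x)) / 2) x"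
      unfolding reflection_increases_def by (meson less_imp_le)
    then show ?thesis by (simp only: refl_diff_def b(1))
  qed
  then show ?thesis by (metis antisym)
qed

text \<open>Composing the reflections in the coordinate directions shows that \<open>u\<close> is symmetric under the point reflection at
the intersection \<open>x0\<close> of their planes. If the plane for \<open>e\<close> missed \<open>x0\<close>, applying twice the point reflection
followed by the mirror would be a translation along \<open>e\<close>, so \<open>u\<close> would be periodic and take the value \<open>u xs > \<l>\<close>
arbitrarily far away.\<close>

lemma symmetric_about_common_point:
  assumes xs: "\<l> < u xs"
  obtains x0 where "\<And>e x. norm e = 1 \<Longrightarrow> u (mirror e (x0 \<bullet> e) x) = u x"
    "\<And>e c. norm e = 1 \<Longrightarrow> c \<le> x0 \<bullet> e \<Longrightarrow> reflection_increases e c"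
proof -
  have "\<forall>e::'a. \<exists>c. norm e = 1 \<longrightarrow> (\<forall>x. u (mirror e c x) = u x) \<and> (\<forall>c'\<le>c. reflection_increases e c')"
    using exists_symmetry_plane[OF _ xs] by metis
  then obtain c where c: "\<And>e x. norm e = 1 \<Longrightarrow> u (mirror e (c e) x) = u x"
    "\<And>e c'. norm e = 1 \<Longrightarrow> c' \<le> c e \<Longrightarrow> reflection_increases e c'"
    by metis
  define x0 where "x0 = (\<Sum>b\<in>Basis. c b *\<^sub>R b)"
  have fold: "u (x - (\<Sum>b\<in>B. (2 * (x \<bullet> b - c b)) *\<^sub>R b)) = u x" if "finite B" "B \<subseteq> Basis" for B x
    using that
  proof (induction B)
    case (insert a B)
    let ?y = "x - (\<Sum>b\<in>B. (2 * (x \<bullet> b - c b)) *\<^sub>R b)"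
    have "(\<Sum>b\<in>B. (2 * (x \<bullet> b - c b)) * (b \<bullet> a)) = 0"
      using insert by (intro sum.neutral) (auto simp: inner_Basis subset_iff)
    then have "?y \<bullet> a = x \<bullet> a" by (simp add: inner_diff_left inner_sum_left)
    then have "x - (\<Sum>b\<in>insert a B. (2 * (x \<bullet> b - c b)) *\<^sub>R b) = mirror a (c a) ?y"
      using insert by (simp add: mirror_def algebra_simps)
    then show ?case using insert c(1)[of a ?y] by simp
  qed simp
  have point: "u (2 *\<^sub>R x0 - x) = u x" for x
  proof -
    have "(\<Sum>b\<in>Basis. (2 * (x \<bullet> b - c b)) *\<^sub>R b) = 2 *\<^sub>R (\<Sum>b\<in>Basis. (x \<bullet> b) *\<^sub>R b) - 2 *\<^sub>R x0"
      unfolding x0_def scaleR_sum_right sum_subtractf[symmetric]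
      by (intro sum.cong) (auto simp: algebra_simps)
    also have "\<dots> = 2 *\<^sub>R x - 2 *\<^sub>R x0" by (simp add: euclidean_representation)
    finally have "x - (\<Sum>b\<in>Basis. (2 * (x \<bullet> b - c b)) *\<^sub>R b) = 2 *\<^sub>R x0 - x"
      by (simp add: scaleR_2)
    then show ?thesis using fold[of Basis x] by simp
  qed
  have same: "c e = x0 \<bullet> e" if e: "norm e = 1" for e
  proof (rule ccontr)
    assume ne: "c e \<noteq> x0 \<bullet> e"
    have ee: "e \<bullet> e = 1" using e by (simp add: norm_eq_1)
    define \<tau> where "\<tau> = c e - x0 \<bullet> e"
    have two: "u (x + (4 * \<tau>) *\<^sub>R e) = u x" for x
    proof -
      have "mirror e (c e) (2 *\<^sub>R x0 - mirror e (c e) (2 *\<^sub>R x0 - x)) = x + (4 * \<tau>) *\<^sub>R e"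
        unfolding mirror_def \<tau>_def
        by (simp add: inner_diff_left inner_diff_right ee algebra_simps)
          (simp add: scaleR_add_left[symmetric])
      then show ?thesis using c(1)[OF e] point by metis
    qed
    have per: "u (xs + (real j * (4 * \<tau>)) *\<^sub>R e) = u xs" for j
    proof (induction j)
      case (Suc j)
      have "xs + (real (Suc j) * (4 * \<tau>)) *\<^sub>R e = (xs + (real j * (4 * \<tau>)) *\<^sub>R e) + (4 * \<tau>) *\<^sub>R e"
        by (simp add: algebra_simps)
      then show ?case using two Suc by metis
    qed simp
    obtain R where R: "\<And>x. R \<le> norm x \<Longrightarrow> u x \<le> \<l>"
      using u_far by (auto simp: eventually_at_infinity)
    obtain j :: nat where j: "(norm xs + \<bar>R\<bar>) / (4 * \<bar>\<tau>\<bar>) < real j" using reals_Archimedean2 by blast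
    have "norm xs + \<bar>R\<bar> < real j * (4 * \<bar>\<tau>\<bar>)"
      using j ne by (simp add: \<tau>_def pos_divide_less_eq)
    also have "\<dots> = norm ((real j * (4 * \<tau>)) *\<^sub>R e)" by (simp add: e abs_mult)
    also have "\<dots> \<le> norm (xs + (real j * (4 * \<tau>)) *\<^sub>R e) + norm xs"
      using norm_triangle_ineq4[of "xs + (real j * (4 * \<tau>)) *\<^sub>R e" xs] by simp
    finally have "R \<le> norm (xs + (real j * (4 * \<tau>)) *\<^sub>R e)" by linarith
    from R[OF this] per[of j] xs show False by simp
  qed
  show thesis by (rule that[of x0]) (use c same in \<open>simp_all add: same\<close>)
qed

text \<open>Points at equal distance from \<open>x0\<close> are exchanged by a reflection in a plane through \<open>x0\<close>, and moving towards
\<open>x0\<close> along a ray is a reflection in a plane that does not separate \<open>x0\<close> from its final position.\<close>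

theorem radial_decreasing: "\<exists>x0. radial_decreasing_about x0 u"
proof (cases "\<exists>xs. \<l> < u xs")
  case False
  then have "u x = u 0" for x using constant_if_small by (meson not_less)
  then show ?thesis
    unfolding radial_decreasing_about_def
    by (intro exI[of _ 0] exI[of _ "\<lambda>_. u 0"]) (auto simp: monotone_on_def)
next
  case True
  then obtain xs where xs: "\<l> < u xs" by blast
  obtain x0 where sym: "\<And>e x. norm e = 1 \<Longrightarrow> u (mirror e (x0 \<bullet> e) x) = u x"
    and incr: "\<And>e c. norm e = 1 \<Longrightarrow> c \<le> x0 \<bullet> e \<Longrightarrow> reflection_increases e c"
    using symmetric_about_common_point[OF xs] by blast
  obtain b :: 'a where b: "norm b = 1" using nonempty_Basis norm_Basis by blast
  have bb: "b \<bullet> b = 1" using b by (simp add: norm_eq_1)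
  define \<phi> where "\<phi> r = u (x0 + r *\<^sub>R b)" for r
  have radial: "u x = u y" if n: "norm (x - x0) = norm (y - x0)" for x y
  proof (cases "x = y")
    case False
    define e where "e = (y - x) /\<^sub>R norm (y - x)"
    note bis = mirror_bisector[OF False, folded e_def]
    have "(y - x) \<bullet> (x + y - 2 *\<^sub>R x0) = (norm (y - x0))\<^sup>2 - (norm (x - x0))\<^sup>2"
      unfolding power2_norm_eq_inner
      by (simp add: inner_diff_left inner_diff_right inner_add_right inner_commute algebra_simps)
    then have "(x + y - 2 *\<^sub>R x0) \<bullet> e = 0"
      using n by (simp add: e_def inner_commute)
    then have "(x + y) \<bullet> e / 2 = x0 \<bullet> e" by (simp add: inner_diff_left)
    then show ?thesis using sym[OF bis(2), of x] bis(1) by simp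
  qed simp
  have "u x = \<phi> (norm (x - x0))" for x
    unfolding \<phi>_def by (rule radial) (simp add: b)
  moreover have "antimono_on {0..} \<phi>"
  proof (rule monotone_onI)
    fix r r' :: real assume r: "r \<in> {0..}" "r' \<in> {0..}" "r \<le> r'"
    let ?c = "- (x0 \<bullet> b) - (r + r') / 2"
    have "reflection_increases (- b) ?c" using r b by (intro incr) auto
    moreover have "(x0 + r' *\<^sub>R b) \<bullet> (- b) \<le> ?c" using r by (simp add: inner_add_left bb field_simps)
    ultimately have "0 \<le> refl_diff (- b) ?c (x0 + r' *\<^sub>R b)" by (simp add: reflection_increases_def)
    moreover have "mirror (- b) ?c (x0 + r' *\<^sub>R b) = x0 + r *\<^sub>R b"
    proof -
      have "2 * ((x0 + r' *\<^sub>R b) \<bullet> (- b) - ?c) = r - r'"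
        by (simp add: inner_add_left bb field_simps)
      then show ?thesis unfolding mirror_def by (simp only:) (simp add: algebra_simps)
    qed
    ultimately show "\<phi> r' \<le> \<phi> r" by (simp add: refl_diff_def \<phi>_def)
  qed
  ultimately show ?thesis unfolding radial_decreasing_about_def by blast
qed

end

section \<open>The modified Bessel function\<close>

lemma integrable_exp_abs:
  assumes "0 < (\<nu>::real)"
  shows "integrable lborel (\<lambda>x. exp (- (\<nu> * \<bar>x\<bar>)))"
proof -
  have "(\<lambda>x. exp (- \<nu> * x)) integrable_on {0..}"
    using has_integral_exp_minus_to_infinity[OF assms, of 0] by blast
  then have "(\<lambda>x. exp (- \<nu> * x)) absolutely_integrable_on {0..}"
    by (intro nonnegative_absolutely_integrable_1) auto
  then have i: "integrable lborel (\<lambda>x. indicat_real {0..} x * exp (- \<nu> * x))"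
    unfolding set_integrable_def by (simp add: integrable_completion)
  have "integrable lborel (\<lambda>x. indicat_real {0..} (- x) * exp (- \<nu> * - x))"
    by (rule integrable_involution[OF _ _ i]) (auto simp: dist_real_def)
  with i have "integrable lborel (\<lambda>x. indicat_real {0..} x * exp (- \<nu> * x) + indicat_real {0..} (- x) * exp (- \<nu> * - x))"
    by simp
  then show ?thesis
    by (rule Bochner_Integration.integrable_bound) (auto intro!: AE_I2 simp: indicator_def abs_if)
qed

text \<open>Substituting \<open>x = t + ln r\<close> in the integral for \<open>K\<^sub>\<nu>(r)\<close> pulls out the factor \<open>r\<^sup>-\<^sup>\<nu>\<close> and leaves an integrand
of this form, up to constants. For \<open>x > 0\<close> the bound comes from the tangent to the exponential at \<open>ln (4 * \<nu>)\<close>.\<close>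

lemma bessel_majorant:
  assumes "0 < (\<nu>::real)"
  obtains D where "0 < D" "\<And>x. exp (\<nu> * x) * exp (- (exp x / 2)) \<le> D * exp (- (\<nu> * \<bar>x\<bar>))"
proof
  define D where "D = max 1 (exp (2 * \<nu> * (ln (4 * \<nu>) - 1)))"
  show "0 < D" by (simp add: D_def)
  fix x :: real
  show "exp (\<nu> * x) * exp (- (exp x / 2)) \<le> D * exp (- (\<nu> * \<bar>x\<bar>))"
  proof (cases "x \<le> 0")
    case True
    have "exp (\<nu> * x) * exp (- (exp x / 2)) \<le> exp (\<nu> * x) * D"
      by (intro mult_left_mono) (auto simp: D_def intro: order_trans[of _ 1])
    then show ?thesis using True by (simp add: mult.commute)
  next
    case False
    have "exp x = 4 * \<nu> * exp (x - ln (4 * \<nu>))" using assms by (simp add: exp_diff)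
    moreover have "4 * \<nu> * (1 + (x - ln (4 * \<nu>))) \<le> 4 * \<nu> * exp (x - ln (4 * \<nu>))"
      using assms by (intro mult_left_mono exp_ge_add_one_self) auto
    ultimately have "2 * (\<nu> * x) - exp x / 2 \<le> 2 * \<nu> * (ln (4 * \<nu>) - 1)" by (simp add: algebra_simps)
    then have "exp (2 * (\<nu> * x) - exp x / 2) \<le> D" by (simp add: D_def max.coboundedI2)
    then have "exp (2 * (\<nu> * x) - exp x / 2) * exp (- (\<nu> * x)) \<le> D * exp (- (\<nu> * x))"
      by (intro mult_right_mono) auto
    then show ?thesis using False by (simp add: exp_add[symmetric])
  qed
qed

lemma bessel_integrand_le:
  fixes \<nu> r t :: real
  assumes "0 < \<nu>" "0 < r" "0 \<le> t"
    and D: "\<And>x. exp (\<nu> * x) * exp (- (exp x / 2)) \<le> D * exp (- (\<nu> * \<bar>x\<bar>))"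
  shows "exp (- (r * cosh t)) * cosh (\<nu> * t) \<le> D * r powr (- \<nu>) * exp (- (\<nu> * \<bar>t + ln r\<bar>))"
proof -
  have "exp t / 2 \<le> cosh t" by (simp add: cosh_field_def)
  then have "r * (exp t / 2) \<le> r * cosh t" using assms by (intro mult_left_mono) auto
  moreover have "exp (t + ln r) = r * exp t" using assms by (simp add: exp_add)
  ultimately have 1: "exp (- (r * cosh t)) \<le> exp (- (exp (t + ln r) / 2))" by simp
  have "0 \<le> \<nu> * t" using assms by simp
  then have "exp (- (\<nu> * t)) \<le> exp (\<nu> * t)" by simp
  then have 2: "cosh (\<nu> * t) \<le> exp (\<nu> * t)" by (simp add: cosh_field_def)
  have "exp (- (r * cosh t)) * cosh (\<nu> * t) \<le> exp (- (exp (t + ln r) / 2)) * exp (\<nu> * t)"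
    using 1 2 by (intro mult_mono) auto
  also have "exp (\<nu> * t) = r powr (- \<nu>) * exp (\<nu> * (t + ln r))"
    using assms by (simp add: powr_def exp_add[symmetric] algebra_simps)
  also have "exp (- (exp (t + ln r) / 2)) * (r powr (- \<nu>) * exp (\<nu> * (t + ln r)))
      = r powr (- \<nu>) * (exp (\<nu> * (t + ln r)) * exp (- (exp (t + ln r) / 2)))" by simp
  also have "\<dots> \<le> r powr (- \<nu>) * (D * exp (- (\<nu> * \<bar>t + ln r\<bar>)))"
    using D by (intro mult_left_mono) auto
  finally show ?thesis by (simp add: mult_ac)
qed

lemma integrable_exp_abs_shift:
  assumes "0 < (\<nu>::real)"
  shows "integrable lborel (\<lambda>t. exp (- (\<nu> * \<bar>t + a\<bar>)))"
    and "(LINT t|lborel. exp (- (\<nu> * \<bar>t + a\<bar>))) = (LINT t|lborel. exp (- (\<nu> * \<bar>t\<bar>)))"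
proof -
  have eq: "(\<lambda>t. exp (- (\<nu> * \<bar>t + a\<bar>))) = (\<lambda>t. exp (- (\<nu> * \<bar>- a - t\<bar>)))"
    by (auto simp: abs_if fun_eq_iff)
  have f: "dist (- a - x) (- a - y) = dist x y" "- a - (- a - x) = x" for x y
    by (auto simp: dist_real_def)
  show "integrable lborel (\<lambda>t. exp (- (\<nu> * \<bar>t + a\<bar>)))"
    unfolding eq by (rule integrable_involution[OF f integrable_exp_abs[OF assms]])
  show "(LINT t|lborel. exp (- (\<nu> * \<bar>t + a\<bar>))) = (LINT t|lborel. exp (- (\<nu> * \<bar>t\<bar>)))"
    unfolding eq by (rule integral_involution[OF f])
qed

definition bessel_integrand :: "real \<Rightarrow> real \<Rightarrow> real \<Rightarrow> real" where
  "bessel_integrand \<nu> r t = indicat_real {0..} t * (exp (- (r * cosh t)) * cosh (\<nu> * t))"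

lemma bessel_K_eq: "bessel_K \<nu> r = (LINT t|lborel. bessel_integrand \<nu> r t)"
  by (simp add: bessel_K_def set_lebesgue_integral_def bessel_integrand_def)

lemma bessel_integrand_nonneg: "0 \<le> bessel_integrand \<nu> r t"
  by (simp add: bessel_integrand_def)

lemma cosh_measurable [measurable]: "(cosh :: real \<Rightarrow> real) \<in> borel_measurable borel"
  by (intro borel_measurable_continuous_onI continuous_intros)

lemma bessel_K_measurable [measurable]: "bessel_K \<nu> \<in> borel_measurable borel"
  unfolding bessel_K_eq[abs_def] bessel_integrand_def by measurable

lemma
  assumes \<nu>: "0 < \<nu>" 
  shows integrable_bessel_integrand: "0 < r \<Longrightarrow> integrable lborel (bessel_integrand \<nu> r)"
    and bessel_K_upper: "\<exists>D>0. \<forall>r>0. bessel_K \<nu> r \<le> D * r powr (- \<nu>)"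
proof -
  obtain D where D: "0 < D" "\<And>x. exp (\<nu> * x) * exp (- (exp x / 2)) \<le> D * exp (- (\<nu> * \<bar>x\<bar>))"
    using bessel_majorant[OF \<nu>] by blast
  have le: "bessel_integrand \<nu> r t \<le> D * r powr (- \<nu>) * exp (- (\<nu> * \<bar>t + ln r\<bar>))" if "0 < r" for r t
    using bessel_integrand_le[OF \<nu> that _ D(2), of t] D(1) by (auto simp: bessel_integrand_def indicator_def)
  have i: "integrable lborel (\<lambda>t. D * r powr (- \<nu>) * exp (- (\<nu> * \<bar>t + ln r\<bar>)))" for r
    using integrable_exp_abs_shift(1)[OF \<nu>] by simp
  show int: "integrable lborel (bessel_integrand \<nu> r)" if "0 < r" for r
  proof (rule Bochner_Integration.integrable_bound[OF i[of r]])
    show "bessel_integrand \<nu> r \<in> borel_measurable lborel" unfolding bessel_integrand_def by measurable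
    show "AE t in lborel. norm (bessel_integrand \<nu> r t) \<le> norm (D * r powr (- \<nu>) * exp (- (\<nu> * \<bar>t + ln r\<bar>)))"
      using le[OF that] D(1) bessel_integrand_nonneg by (intro AE_I2) simp
  qed
  define E where "E = (LINT t|lborel. exp (- (\<nu> * \<bar>t\<bar>)))"
  have E: "0 \<le> E" unfolding E_def by (intro integral_nonneg_AE) auto
  show "\<exists>D>0. \<forall>r>0. bessel_K \<nu> r \<le> D * r powr (- \<nu>)"
  proof (intro exI[of _ "D * (E + 1)"] conjI allI impI)
    fix r :: real assume r: "0 < r"
    have "bessel_K \<nu> r \<le> (LINT t|lborel. D * r powr (- \<nu>) * exp (- (\<nu> * \<bar>t + ln r\<bar>)))"
      unfolding bessel_K_eq using int[OF r] i le[OF r] by (intro integral_mono) auto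
    also have "\<dots> = D * E * r powr (- \<nu>)"
      using integrable_exp_abs_shift(2)[OF \<nu>] by (simp add: E_def)
    also have "\<dots> \<le> D * (E + 1) * r powr (- \<nu>)"
      using D(1) by (intro mult_right_mono) auto
    finally show "bessel_K \<nu> r \<le> D * (E + 1) * r powr (- \<nu>)" .
  qed (use D E in auto)
qed

text \<open>The integrand decreases in \<open>r\<close> for each \<open>t\<close>; on \<open>[0,1]\<close> it does so by at least a constant, which makes
the monotonicity strict after integration.\<close>

lemma bessel_K_strict_antimono:
  assumes \<nu>: "0 < \<nu>" and r: "0 < r" "r < r'"
  shows "bessel_K \<nu> r' < bessel_K \<nu> r"
proof -
  define \<kappa> where "\<kappa> = exp (- (r * cosh 1)) * (1 - exp (- (r' - r)))"
  have \<kappa>: "0 < \<kappa>" using r by (simp add: \<kappa>_def)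
  have i: "integrable lborel (bessel_integrand \<nu> r)" "integrable lborel (bessel_integrand \<nu> r')"
    using integrable_bessel_integrand[OF \<nu>] r by auto
  have "\<kappa> = (LINT t|lborel. \<kappa> * indicat_real {0..1::real} t)" by simp
  also have "\<dots> \<le> (LINT t|lborel. bessel_integrand \<nu> r t - bessel_integrand \<nu> r' t)"
  proof (rule integral_mono)
    show "integrable lborel (\<lambda>t. \<kappa> * indicat_real {0..1::real} t)"
      by (intro integrable_mult_right integrable_real_indicator) auto
    fix t :: real
    have split: "exp (- (r * cosh t)) - exp (- (r' * cosh t))
        = exp (- (r * cosh t)) * (1 - exp (- ((r' - r) * cosh t)))"
      by (simp add: algebra_simps exp_add[symmetric])
    have c1: "1 \<le> cosh x" for x :: real by (rule cosh_real_ge_1)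
    have pos: "1 - exp (- (r' - r)) \<le> 1 - exp (- ((r' - r) * cosh t))"
    proof -
      have "(r' - r) * 1 \<le> (r' - r) * cosh t" using r c1[of t] by (intro mult_left_mono) auto
      then have "- ((r' - r) * cosh t) \<le> - (r' - r)" unfolding neg_le_iff_le by (simp only: mult_1_right)
      then show ?thesis by simp
    qed
    have nn: "0 \<le> 1 - exp (- (r' - r))" using r by simp
    show "\<kappa> * indicat_real {0..1} t \<le> bessel_integrand \<nu> r t - bessel_integrand \<nu> r' t"
    proof (cases "0 \<le> t")
      case True
      have eq: "bessel_integrand \<nu> r t - bessel_integrand \<nu> r' t =
          (exp (- (r * cosh t)) * (1 - exp (- ((r' - r) * cosh t)))) * cosh (\<nu> * t)"
        using True unfolding split[symmetric] by (simp add: bessel_integrand_def left_diff_distrib)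
      show ?thesis
      proof (cases "t \<le> 1")
        case True
        have "cosh t \<le> cosh 1" using True \<open>0 \<le> t\<close> by (subst cosh_real_nonneg_le_iff) auto
        then have "exp (- (r * cosh 1)) \<le> exp (- (r * cosh t))" using r by simp
        then have "\<kappa> \<le> exp (- (r * cosh t)) * (1 - exp (- ((r' - r) * cosh t)))"
          unfolding \<kappa>_def using pos nn by (intro mult_mono) auto
        also have "\<dots> \<le> \<dots> * cosh (\<nu> * t)"
          using c1[of "\<nu> * t"] pos nn mult_left_mono[of 1 "cosh (\<nu> * t)" "exp (- (r * cosh t)) * (1 - exp (- ((r' - r) * cosh t)))"]
          by simp
        finally show ?thesis using True \<open>0 \<le> t\<close> unfolding eq by simp
      next
        case False
        then show ?thesis unfolding eq using pos nn by (auto intro!: mult_nonneg_nonneg)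
      qed
    qed (simp add: bessel_integrand_def)
  qed (use i in auto)
  also have "\<dots> = bessel_K \<nu> r - bessel_K \<nu> r'" using i by (simp add: bessel_K_eq)
  finally show ?thesis using \<kappa> by simp
qed

lemma bessel_K_nonneg: "0 \<le> bessel_K \<nu> r"
  unfolding bessel_K_eq using bessel_integrand_nonneg by (intro integral_nonneg_AE) auto

lemma bessel_K_pos: "0 < \<nu> \<Longrightarrow> 0 < r \<Longrightarrow> 0 < bessel_K \<nu> r"
  using bessel_K_strict_antimono[of \<nu> r "r + 1"] bessel_K_nonneg[of \<nu> "r + 1"] by simp

text \<open>On the window \<open>- 1 \<le> t + ln r \<le> 0\<close> the exponential factor is at least \<open>exp (- 1)\<close> and the hyperbolic cosine
at least \<open>exp (- \<nu>) * r powr (- \<nu>) / 2\<close>. The bound on \<open>r\<close> keeps the window inside the range \<open>t \<ge> 0\<close>.\<close>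

lemma bessel_K_lower:
  assumes \<nu>: "0 < \<nu>" and r: "0 < r" "r \<le> exp (- 1)"
  shows "exp (- 1 - \<nu>) / 2 * r powr (- \<nu>) \<le> bessel_K \<nu> r"
proof -
  let ?c = "exp (- 1 - \<nu>) / 2 * r powr (- \<nu>)"
  have lr: "ln r \<le> - 1" using r by (metis ln_exp ln_mono exp_gt_zero)
  have "?c = (LINT t|lborel. ?c * indicat_real {- 1 - ln r..- ln r} t)" by simp
  also have "\<dots> \<le> bessel_K \<nu> r"
    unfolding bessel_K_eq
  proof (rule integral_mono)
    show "integrable lborel (\<lambda>t. ?c * indicat_real {- 1 - ln r..- ln r} t)"
      by (intro integrable_mult_right integrable_real_indicator) auto
    fix t :: real
    show "?c * indicat_real {- 1 - ln r..- ln r} t \<le> bessel_integrand \<nu> r t"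
    proof (cases "t \<in> {- 1 - ln r..- ln r}")
      case True
      then have t: "0 \<le> t" "- 1 \<le> t + ln r" "t + ln r \<le> 0" using lr by auto
      have "cosh t \<le> exp t" using t by (simp add: cosh_field_def)
      then have "r * cosh t \<le> r * exp t" using r by (intro mult_left_mono) auto
      also have "r * exp t = exp (t + ln r)" using r by (simp add: exp_add)
      also have "\<dots> \<le> 1" using t by simp
      finally have 1: "exp (- 1) \<le> exp (- (r * cosh t))" by simp
      have "\<nu> * (- 1) \<le> \<nu> * (t + ln r)" using \<nu> t by (intro mult_left_mono) auto
      then have "exp (- \<nu>) * r powr (- \<nu>) \<le> exp (\<nu> * t)"
        using r by (simp add: powr_def exp_add[symmetric] algebra_simps)
      also have "\<dots> \<le> 2 * cosh (\<nu> * t)" by (simp add: cosh_field_def)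
      finally have 2: "exp (- \<nu>) * r powr (- \<nu>) / 2 \<le> cosh (\<nu> * t)" by simp
      have "?c = exp (- 1) * (exp (- \<nu>) * r powr (- \<nu>) / 2)" by (simp add: exp_diff exp_minus field_simps)
      also have "\<dots> \<le> exp (- (r * cosh t)) * cosh (\<nu> * t)" using 1 2 by (intro mult_mono) auto
      finally show ?thesis using True t by (simp add: bessel_integrand_def)
    qed (simp add: bessel_integrand_nonneg)
  qed (use integrable_bessel_integrand[OF \<nu> r(1)] in auto)
  finally show ?thesis .
qed

section \<open>The Bessel kernel and the conclusion\<close>

lemma dyadic_scale:
  assumes "0 < (r::real)"
  obtains j :: int where "2 powr real_of_int j \<le> r" "r < 2 powr (real_of_int j + 1)"
proof
  have "2 powr real_of_int \<lfloor>log 2 r\<rfloor> \<le> 2 powr (log 2 r)" by (intro powr_mono) auto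
  then show "2 powr real_of_int \<lfloor>log 2 r\<rfloor> \<le> r" using assms by simp
  have "2 powr (log 2 r) < 2 powr (real_of_int \<lfloor>log 2 r\<rfloor> + 1)" by (intro powr_less_mono) auto
  then show "r < 2 powr (real_of_int \<lfloor>log 2 r\<rfloor> + 1)" using assms by simp
qed

lemma summable_two_powr:
  assumes "0 < (a::real)"
  shows "summable (\<lambda>j::nat. c * 2 powr (b - a * real j))"
proof -
  have "2 powr (b - a * real j) = 2 powr b * (2 powr (- a)) ^ j" for j :: nat
    by (simp add: powr_power powr_add[symmetric] mult.commute)
  then have eq: "(\<lambda>j::nat. c * 2 powr (b - a * real j)) = (\<lambda>j. c * (2 powr b * (2 powr (- a)) ^ j))"
    by simp
  show ?thesis
    unfolding eq
  proof (intro summable_mult summable_geometric)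
    have "2 powr (- a) < 2 powr (0::real)" using assms by (intro powr_less_mono) auto
    then show "norm (2 powr (- a)) < 1" by simp
  qed
qed

text \<open>The ball and its complement are cut into dyadic shells; the shell of radius \<open>2\<^sup>j\<close> carries a mass of order
\<open>2\<^sup>-\<^sup>2\<^sup>s\<^sup>j\<close> for \<open>j \<ge> 0\<close> and of order \<open>2\<^sup>(\<^sup>2\<^sup>-\<^sup>2\<^sup>s\<^sup>)\<^sup>j\<close> for \<open>j < 0\<close>, and both geometric series converge as \<open>0 < s < 1\<close>.\<close>

lemma integrable_levy_weight:
  fixes k :: "real \<Rightarrow> real"
  assumes s: "0 < s" "s < 1" and [measurable]: "k \<in> borel_measurable borel"
    and nn: "\<And>r. 0 < r \<Longrightarrow> 0 \<le> k r"
    and E: "\<And>r. 0 < r \<Longrightarrow> k r \<le> E * r powr (- (real DIM('a) + 2 * s))"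
  shows "integrable lborel (\<lambda>h::'a::euclidean_space. min 1 ((norm h)\<^sup>2) * k (norm h))"
proof -
  let ?N = "real DIM('a)"
  let ?f = "\<lambda>h::'a. min 1 ((norm h)\<^sup>2) * k (norm h)"
  have fmeas: "?f \<in> borel_measurable borel" by measurable
  have E0: "0 \<le> E" using nn[of 1] E[of 1] by simp
  have fnn: "0 \<le> ?f h" for h using nn[of "norm h"] by (cases "h = 0") auto
  have kle: "k r \<le> E * (2 powr real_of_int j) powr (- (?N + 2 * s))" if "2 powr real_of_int j \<le> r" for r and j :: int
  proof -
    have j0: "0 < 2 powr real_of_int j" by simp
    then have r: "0 < r" using that by linarith
    have "r powr (- (?N + 2 * s)) \<le> (2 powr real_of_int j) powr (- (?N + 2 * s))"
      using that s by (intro powr_mono2') auto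
    then have "E * r powr (- (?N + 2 * s)) \<le> E * (2 powr real_of_int j) powr (- (?N + 2 * s))"
      using E0 by (intro mult_left_mono) auto
    with E[OF r] show ?thesis by linarith
  qed
  have pw: "(2 powr x) ^ DIM('a) = 2 powr (?N * x)" for x :: real
    by (simp add: powr_power mult.commute)
  have far: "integrable lborel (\<lambda>h. indicat_real (- ball 0 1) h * ?f h)"
  proof (rule integrable_radial_if_dominated_by_balls)
    show "(\<lambda>h. indicat_real (- ball 0 1) h * ?f h) \<in> borel_measurable borel"
      by (intro borel_measurable_times borel_measurable_indicator fmeas) simp
    show "0 \<le> indicat_real (- ball 0 1) h * ?f h" for h using fnn by simp
    let ?c = "\<lambda>j::nat. E * 2 powr (- (?N + 2 * s) * real j)" and ?R = "\<lambda>j::nat. 2 powr (real j + 1)"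
    show "0 \<le> ?c j" "0 \<le> ?R j" for j using E0 by auto
    have "?c j * ?R j ^ DIM('a) = E * 2 powr (?N - (2 * s) * real j)" for j
      by (simp add: pw powr_add[symmetric] algebra_simps)
    moreover have "summable (\<lambda>j. E * 2 powr (?N - (2 * s) * real j))"
      by (rule summable_two_powr) (use s in simp)
    ultimately show "summable (\<lambda>j. ?c j * ?R j ^ DIM('a))" by (simp only:)
    fix x :: 'a assume "indicat_real (- ball 0 1) x * ?f x \<noteq> 0"
    then have x: "1 \<le> norm x" by (auto simp: indicator_def split: if_splits)
    then obtain j :: int where j: "2 powr real_of_int j \<le> norm x" "norm x < 2 powr (real_of_int j + 1)"
      using dyadic_scale[of "norm x"] by (metis less_le_trans zero_less_one)
    have "2 powr 0 < 2 powr (real_of_int j + 1)" using j x by simp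
    then have "0 < real_of_int j + 1" by (subst (asm) powr_less_cancel_iff) auto
    then have jn: "real (nat j) = real_of_int j" by auto
    have "1 \<le> (norm x)\<^sup>2" using x by (simp add: one_le_power)
    then have "?f x = k (norm x)" by simp
    also have "\<dots> \<le> ?c (nat j)" using kle[OF j(1)] by (simp add: powr_powr jn mult.commute)
    finally have "indicat_real (- ball 0 1) x * ?f x \<le> ?c (nat j)" using x by simp
    moreover have "x \<in> ball 0 (?R (nat j))" using j jn by simp
    ultimately show "\<exists>j. x \<in> ball 0 (?R j) \<and> indicat_real (- ball 0 1) x * ?f x \<le> ?c j" by blast
  qed
  have near: "integrable lborel (\<lambda>h. indicat_real (ball 0 1) h * ?f h)"
  proof (rule integrable_radial_if_dominated_by_balls)
    show "(\<lambda>h. indicat_real (ball 0 1) h * ?f h) \<in> borel_measurable borel"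
      by (intro borel_measurable_times borel_measurable_indicator fmeas) simp
    show "0 \<le> indicat_real (ball 0 1) h * ?f h" for h using fnn by simp
    let ?c = "\<lambda>j::nat. E * 2 powr (2 + (?N + 2 * s - 2) * real j)" and ?R = "\<lambda>j::nat. 2 powr (1 - real j)"
    show "0 \<le> ?c j" "0 \<le> ?R j" for j using E0 by auto
    have "?c j * ?R j ^ DIM('a) = E * 2 powr ((?N + 2) - (2 - 2 * s) * real j)" for j
      by (simp add: pw powr_add[symmetric] algebra_simps)
    moreover have "summable (\<lambda>j. E * 2 powr ((?N + 2) - (2 - 2 * s) * real j))"
      by (rule summable_two_powr) (use s in simp)
    ultimately show "summable (\<lambda>j. ?c j * ?R j ^ DIM('a))" by (simp only:)
    fix x :: 'a assume ne: "indicat_real (ball 0 1) x * ?f x \<noteq> 0"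
    then have x: "norm x < 1" "0 < norm x" by (auto simp: indicator_def split: if_splits)
    then obtain j :: int where j: "2 powr real_of_int j \<le> norm x" "norm x < 2 powr (real_of_int j + 1)"
      using dyadic_scale[of "norm x"] by (metis less_le_trans zero_less_one)
    have "2 powr (real_of_int j) < 2 powr 0" using j x by simp
    then have "real_of_int j < 0" by (subst (asm) powr_less_cancel_iff) auto
    then have jn: "real (nat (- j)) = - real_of_int j" by auto
    have "(norm x)\<^sup>2 \<le> (2 powr (real_of_int j + 1))\<^sup>2" using j by (intro power_mono) auto
    also have "\<dots> = 2 powr (2 * real_of_int j + 2)" by (simp add: powr_power algebra_simps)
    finally have n2: "(norm x)\<^sup>2 \<le> 2 powr (2 * real_of_int j + 2)" .
    have "?f x \<le> (norm x)\<^sup>2 * k (norm x)" using nn[OF x(2)] by (intro mult_right_mono) auto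
    also have "\<dots> \<le> 2 powr (2 * real_of_int j + 2) * (E * (2 powr real_of_int j) powr (- (?N + 2 * s)))"
      using n2 kle[OF j(1)] nn[OF x(2)] by (intro mult_mono) auto
    also have "\<dots> = E * (2 powr (2 * real_of_int j + 2) * 2 powr (real_of_int j * (- (?N + 2 * s))))"
      by (simp add: powr_powr)
    also have "\<dots> = ?c (nat (- j))"
      by (simp add: powr_add[symmetric] jn algebra_simps)
    finally have "indicat_real (ball 0 1) x * ?f x \<le> ?c (nat (- j))" using x by simp
    moreover have "x \<in> ball 0 (?R (nat (- j)))" using j jn by (simp add: add.commute)
    ultimately show "\<exists>j. x \<in> ball 0 (?R j) \<and> indicat_real (ball 0 1) x * ?f x \<le> ?c j" by blast
  qed
  have "(\<lambda>h. indicat_real (ball 0 1) h * ?f h + indicat_real (- ball 0 1) h * ?f h) = ?f"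
    by (auto simp: indicator_def)
  with Bochner_Integration.integrable_add[OF near far] show ?thesis by simp
qed

definition bessel_kernel :: "real \<Rightarrow> real \<Rightarrow> real \<Rightarrow> real" where
  "bessel_kernel \<nu> m r = bessel_K \<nu> (m * r) / r powr \<nu>"

lemma
  fixes \<nu> m :: real
  assumes \<nu>: "0 < \<nu>" and m: "0 < m"
  shows bessel_kernel_pos: "0 < r \<Longrightarrow> 0 < bessel_kernel \<nu> m r"
    and bessel_kernel_strict_antimono: "0 < r \<Longrightarrow> r < r' \<Longrightarrow> bessel_kernel \<nu> m r' < bessel_kernel \<nu> m r"
    and bessel_kernel_upper: "\<exists>E. \<forall>r>0. bessel_kernel \<nu> m r \<le> E * r powr (- (2 * \<nu>))"
    and bessel_kernel_lower: "\<exists>c>0. \<exists>r0>0. \<forall>r. 0 < r \<longrightarrow> r < r0 \<longrightarrow> c * r powr (- (2 * \<nu>)) \<le> bessel_kernel \<nu> m r"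
proof -
  show "0 < bessel_kernel \<nu> m r" if "0 < r" for r
    using bessel_K_pos[OF \<nu>, of "m * r"] m that by (simp add: bessel_kernel_def)
  show "bessel_kernel \<nu> m r' < bessel_kernel \<nu> m r" if r: "0 < r" "r < r'" for r r'
    unfolding bessel_kernel_def
  proof (rule frac_less2)
    show "0 < bessel_K \<nu> (m * r')" using bessel_K_pos[OF \<nu>] m r by simp
    show "bessel_K \<nu> (m * r') \<le> bessel_K \<nu> (m * r)"
      using bessel_K_strict_antimono[OF \<nu>, of "m * r" "m * r'"] m r by simp
    show "r powr \<nu> < r' powr \<nu>" using r \<nu> by (intro powr_less_mono2) auto
  qed (use r in auto)
  have scale: "(m * r) powr (- \<nu>) / r powr \<nu> = m powr (- \<nu>) * r powr (- (2 * \<nu>))" if "0 < r" for r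
    using that m by (simp add: powr_mult powr_minus powr_add[symmetric] field_simps flip: powr_add)
  obtain D where D: "\<And>r. 0 < r \<Longrightarrow> bessel_K \<nu> r \<le> D * r powr (- \<nu>)"
    using bessel_K_upper[OF \<nu>] by blast
  show "\<exists>E. \<forall>r>0. bessel_kernel \<nu> m r \<le> E * r powr (- (2 * \<nu>))"
  proof (intro exI[of _ "D * m powr (- \<nu>)"] allI impI)
    fix r :: real assume r: "0 < r"
    have "bessel_kernel \<nu> m r \<le> D * (m * r) powr (- \<nu>) / r powr \<nu>"
      unfolding bessel_kernel_def using D[of "m * r"] r m by (intro divide_right_mono) auto
    also have "\<dots> = D * m powr (- \<nu>) * r powr (- (2 * \<nu>))"
      by (metis scale[OF r] mult.assoc times_divide_eq_right)
    finally show "bessel_kernel \<nu> m r \<le> D * m powr (- \<nu>) * r powr (- (2 * \<nu>))" .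
  qed
  have "exp (- 1 - \<nu>) / 2 * m powr (- \<nu>) * r powr (- (2 * \<nu>)) \<le> bessel_kernel \<nu> m r"
    if r: "0 < r" "r < exp (- 1) / m" for r
  proof -
    have "exp (- 1 - \<nu>) / 2 * m powr (- \<nu>) * r powr (- (2 * \<nu>)) = exp (- 1 - \<nu>) / 2 * (m * r) powr (- \<nu>) / r powr \<nu>"
      by (metis scale[OF r(1)] mult.assoc times_divide_eq_right)
    also have "\<dots> \<le> bessel_kernel \<nu> m r"
      unfolding bessel_kernel_def using bessel_K_lower[OF \<nu>, of "m * r"] r m
      by (intro divide_right_mono) (auto simp: field_simps)
    finally show ?thesis .
  qed
  moreover have "0 < exp (- 1 - \<nu>) / 2 * m powr (- \<nu>)" "0 < exp (- 1) / m" using m by auto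
  ultimately show "\<exists>c>0. \<exists>r0>0. \<forall>r. 0 < r \<longrightarrow> r < r0 \<longrightarrow> c * r powr (- (2 * \<nu>)) \<le> bessel_kernel \<nu> m r" by blast
qed

text \<open>Applied with \<open>L\<close> a bound for \<open>u\<close> near infinity and with \<open>L\<close> a global bound, this gives the two one-sided Lipschitz bounds
on the nonlinearity.\<close>

lemma powr_diff_le:
  fixes a b L p :: real
  assumes "0 \<le> a" "a \<le> b" "b \<le> L" "1 < p"
  shows "b powr p - a powr p \<le> p * L powr (p - 1) * (b - a)"
proof (cases "a = 0 \<or> a = b")
  case True
  show ?thesis
  proof (cases "a = b")
    case False
    with True assms have a: "a = 0" and b: "0 < b" by auto
    have "b powr p = b powr (p - 1) * b" using b powr_add[of b "p - 1" 1] by simp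
    also have "\<dots> \<le> (p * L powr (p - 1)) * b"
    proof (intro mult_right_mono)
      have "b powr (p - 1) \<le> L powr (p - 1)" using assms b by (intro powr_mono2) auto
      also have "\<dots> \<le> p * L powr (p - 1)" using assms mult_right_mono[of 1 p "L powr (p - 1)"] by simp
      finally show "b powr (p - 1) \<le> p * L powr (p - 1)" .
    qed (use b in simp)
    finally show ?thesis by (simp add: a)
  qed simp
next
  case False
  then have ab: "0 < a" "a < b" using assms by auto
  have "\<exists>z. a < z \<and> z < b \<and> b powr p - a powr p = (b - a) * (p * z powr (p - 1))"
    using ab by (intro MVT2) (auto intro!: derivative_eq_intros simp: powr_diff)
  then obtain z where z: "a < z" "z < b" "b powr p - a powr p = (b - a) * (p * z powr (p - 1))" by blast
  have "z powr (p - 1) \<le> L powr (p - 1)" using z ab assms by (intro powr_mono2) auto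
  then have "(b - a) * (p * z powr (p - 1)) \<le> (b - a) * (p * L powr (p - 1))"
    using ab assms by (intro mult_left_mono) auto
  then show ?thesis using z by (simp add: mult_ac)
qed

lemma C11_loc_continuous:
  assumes "u \<in> C11_loc"
  shows "continuous_on UNIV u"
proof (intro continuous_at_imp_continuous_on ballI)
  fix x
  obtain g where "GDERIV u x :> g x" using assms unfolding C11_loc_def by blast
  then show "isCont u x" unfolding gderiv_def by (rule has_derivative_continuous)
qed

lemma bounded_above_if_eventually_le:
  fixes u :: "'a::euclidean_space \<Rightarrow> real"
  assumes "continuous_on UNIV u" "eventually (\<lambda>x. u x \<le> l) at_infinity"
  obtains M where "\<And>x. u x \<le> M"
proof -
  obtain R where R: "\<And>x. R \<le> norm x \<Longrightarrow> u x \<le> l"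
    using assms(2) by (auto simp: eventually_at_infinity)
  have cont: "continuous_on (cball 0 R) u" using assms(1) by (rule continuous_on_subset) simp
  have "bdd_above (u ` cball 0 R)"
    by (rule bounded_imp_bdd_above[OF compact_imp_bounded[OF compact_continuous_image[OF cont compact_cball]]])
  then obtain B where B: "\<And>x. x \<in> cball 0 R \<Longrightarrow> u x \<le> B"
    unfolding bdd_above_def by blast
  have "u x \<le> max l B" for x
    using R[of x] B[of x] by (cases "R \<le> norm x") (simp_all add: le_max_iff_disj)
  then show thesis by (rule that)
qed

lemma solution_truncated_limit:
  fixes u :: "'a::euclidean_space \<Rightarrow> real"
  assumes sol: "is_solution m s \<omega> p u" and s: "0 < s" "s < 1" and m: "0 < m"
  shows "((\<lambda>\<epsilon>. LINT y:- ball x \<epsilon>|lborel. (u x - u y) * bessel_kernel (real DIM('a) / 2 + s) m (norm (x - y)))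
    \<longlongrightarrow> (u x powr p - (\<omega> + m powr (2 * s)) * u x) / (c_const DIM('a) s * m powr (real DIM('a) / 2 + s)))
    (at_right 0)"
proof -
  let ?c = "c_const DIM('a) s * m powr (real DIM('a) / 2 + s)"
  have c: "0 < ?c" unfolding c_const_def using s m by (simp add: Gamma_real_pos)
  have f: "frac_integrand m s u x y = (u x - u y) * bessel_kernel (real DIM('a) / 2 + s) m (norm (x - y))" for y
    by (simp add: frac_integrand_def bessel_kernel_def)
  from sol have "pv_exists (frac_integrand m s u x) x" and eq: "frac_op m s u x + \<omega> * u x = u x powr p"
    by (auto simp: is_solution_def)
  then obtain I where I: "((\<lambda>\<epsilon>. LINT y:- ball x \<epsilon>|lborel. frac_integrand m s u x y) \<longlongrightarrow> I) (at_right 0)"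
    by (auto simp: pv_exists_def)
  then have "pv_integral (frac_integrand m s u x) x = I"
    unfolding pv_integral_def by (intro tendsto_Lim) auto
  with eq have "?c * I = u x powr p - (\<omega> + m powr (2 * s)) * u x"
    by (simp add: frac_op_def algebra_simps)
  then have "I = (u x powr p - (\<omega> + m powr (2 * s)) * u x) / ?c"
    using c by (subst nonzero_eq_divide_eq) (simp_all only: less_imp_neq[symmetric] mult.commute not_False_eq_True)
  with I show ?thesis by (simp add: f)
qed

theorem theorem2p24:
  fixes u :: "real ^ 'n \<Rightarrow> real" and s m \<omega> p l :: real
  assumes "0 < s" and "s < 1" and "m > 0"
    and "\<omega> > - (m powr (2 * s))" and "1 < p"
    and "u \<in> L_space s" and "u \<in> C11_loc"
    and "\<And>x. 0 \<le> u x"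
    and "is_solution m s \<omega> p u"
    and "Limsup at_infinity (\<lambda>x. ereal (u x)) = ereal l"
    and "l < ((\<omega> + m powr (2 * s)) / p) powr (1 / (p - 1))"
  shows "\<exists>x0. radial_decreasing_about x0 u"
proof -
  let ?N = "DIM(real ^ 'n)"
  define \<nu> where "\<nu> = real ?N / 2 + s"
  have \<nu>: "0 < \<nu>" using assms(1) by (simp add: \<nu>_def)
  have \<nu>2: "2 * \<nu> = real ?N + 2 * s" by (simp add: \<nu>_def)
  let ?k = "bessel_kernel \<nu> m"
  define \<kappa> where "\<kappa> = \<omega> + m powr (2 * s)"
  define \<sigma> where "\<sigma> = c_const ?N s * m powr \<nu>"
  have \<kappa>: "0 < \<kappa>" using assms(4) by (simp add: \<kappa>_def)
  have \<sigma>: "0 < \<sigma>" unfolding \<sigma>_def c_const_def using assms(1-3) by (simp add: Gamma_real_pos)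
  define T where "T = (\<kappa> / p) powr (1 / (p - 1))"
  have T: "0 < T" "l < T" using \<kappa> assms(5,11) by (auto simp: T_def \<kappa>_def)
  then obtain \<l> where \<l>: "max l 0 < \<l>" "\<l> < T" using dense[of "max l 0" T] by auto
  have "\<l> powr (p - 1) < T powr (p - 1)" using \<l> assms(5) by (intro powr_less_mono2) auto
  also have "T powr (p - 1) = \<kappa> / p" using \<kappa> assms(5) by (simp add: T_def powr_powr)
  finally have sub: "p * \<l> powr (p - 1) < \<kappa>" using assms(5) by (simp add: field_simps)
  have cont: "continuous_on UNIV u" by (rule C11_loc_continuous[OF assms(7)])
  have "eventually (\<lambda>x. ereal (u x) < ereal \<l>) at_infinity"
    by (rule Limsup_lessD) (use assms(10) \<l> in simp)
  then have far: "eventually (\<lambda>x. u x \<le> \<l>) at_infinity"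
    by (rule eventually_mono) simp
  obtain M where M: "\<And>x. u x \<le> M" using bounded_above_if_eventually_le[OF cont far] by blast
  define g where "g t = (t powr p - \<kappa> * t) / \<sigma>" for t
  have g_diff: "g b - g a \<le> (p * L powr (p - 1) - \<kappa>) / \<sigma> * (b - a)" if "0 \<le> a" "a \<le> b" "b \<le> L" for a b L
  proof -
    have "g b - g a = ((b powr p - a powr p) - \<kappa> * (b - a)) / \<sigma>"
      by (simp add: g_def diff_divide_distrib[symmetric] algebra_simps)
    also have "\<dots> \<le> (p * L powr (p - 1) * (b - a) - \<kappa> * (b - a)) / \<sigma>"
      using powr_diff_le[OF that assms(5)] \<sigma> by (intro divide_right_mono) auto
    finally show ?thesis by (simp add: algebra_simps)
  qed
  interpret nonlocal_equation ?k u g M \<l> "(\<kappa> - p * \<l> powr (p - 1)) / \<sigma>" "(p * M powr (p - 1) - \<kappa>) / \<sigma>"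
  proof
    show "0 < r \<Longrightarrow> 0 < ?k r" for r by (rule bessel_kernel_pos[OF \<nu> assms(3)])
    show "0 < r \<Longrightarrow> r < r' \<Longrightarrow> ?k r' < ?k r" for r r'
      by (rule bessel_kernel_strict_antimono[OF \<nu> assms(3)])
    show meas: "?k \<in> borel_measurable borel" unfolding bessel_kernel_def by measurable
    obtain E where E: "\<And>r. 0 < r \<Longrightarrow> ?k r \<le> E * r powr (- (real ?N + 2 * s))"
      using bessel_kernel_upper[OF \<nu> assms(3)] unfolding \<nu>2 by blast
    show "integrable lborel (\<lambda>h::real ^ 'n. min 1 ((norm h)\<^sup>2) * ?k (norm h))"
      by (rule integrable_levy_weight[OF assms(1,2) meas _ E]) (rule less_imp_le[OF bessel_kernel_pos[OF \<nu> assms(3)]])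
    show "filterlim (\<lambda>r. r ^ ?N * ?k r) at_top (at_right 0)"
    proof -
      obtain c r0 where c: "0 < c" "0 < r0"
        "\<And>r. 0 < r \<Longrightarrow> r < r0 \<Longrightarrow> c * r powr (- (real ?N + 2 * s)) \<le> ?k r"
        using bessel_kernel_lower[OF \<nu> assms(3)] unfolding \<nu>2 by blast
      have "filterlim (\<lambda>r. c * r powr (- (2 * s))) at_top (at_right 0)"
      proof -
        have "eventually (\<lambda>r::real. 0 \<le> r) (at_right 0)"
          by (rule eventually_mono[OF eventually_at_right_less]) simp
        then have "((\<lambda>r::real. r powr (2 * s)) \<longlongrightarrow> 0) (at_right 0)"
          using assms(1)
          by (intro tendsto_zero_powrI[OF tendsto_ident_at tendsto_const]) auto
        then have "filterlim (\<lambda>r::real. inverse (r powr (2 * s))) at_top (at_right 0)"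
          by (rule filterlim_inverse_at_top) (rule eventually_mono[OF eventually_at_right_less], simp)
        then show ?thesis
          using c(1) by (simp only: powr_minus) (rule filterlim_tendsto_pos_mult_at_top[OF tendsto_const])
      qed
      moreover have "eventually (\<lambda>r. c * r powr (- (2 * s)) \<le> r ^ ?N * ?k r) (at_right 0)"
        unfolding eventually_at_right_field
      proof (intro exI[of _ r0] conjI allI impI)
        fix r :: real assume r: "0 < r" "r < r0"
        have "c * r powr (- (2 * s)) = r ^ ?N * (c * r powr (- (real ?N + 2 * s)))"
          using r by (simp add: powr_realpow[symmetric] powr_add[symmetric])
        also have "\<dots> \<le> r ^ ?N * ?k r" using c(3)[OF r] r by (intro mult_left_mono) auto
        finally show "c * r powr (- (2 * s)) \<le> r ^ ?N * ?k r" .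
      qed (use c in auto)
      ultimately show ?thesis by (rule filterlim_at_top_mono)
    qed
    show "((\<lambda>\<epsilon>. LINT y:- ball x \<epsilon>|lborel. (u x - u y) * ?k (norm (x - y))) \<longlongrightarrow> g (u x)) (at_right 0)" for x
      using solution_truncated_limit[OF assms(9,1,2,3), of x] by (simp add: \<nu>_def g_def \<kappa>_def \<sigma>_def)
    show "g b - g a \<le> - ((\<kappa> - p * \<l> powr (p - 1)) / \<sigma>) * (b - a)" if "0 \<le> a" "a \<le> b" "b \<le> \<l>" for a b
      using g_diff[OF that] by (simp add: minus_divide_left)
    show "0 < (\<kappa> - p * \<l> powr (p - 1)) / \<sigma>" using sub \<sigma> by simp
    show "g b - g a \<le> (p * M powr (p - 1) - \<kappa>) / \<sigma> * (b - a)" if "0 \<le> a" "a \<le> b" "b \<le> M" for a b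
      by (rule g_diff[OF that])
  qed (fact cont far M assms(8))+
  show ?thesis by (rule radial_decreasing)
qed

end
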